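(* On a set $X$ of infinite cardinality $\aleph_\alpha$ there exist (exactly) $2\,|\alpha|+5$ maximal submonoids of $\mathcal{O}^{(1)}$ that contain all permutations of $X$. Hence the smallest cardinality on which there are infinitely many such monoids is $\aleph_\omega$.
   Context: $\mathcal{O}^{(1)}$ is the monoid of all functions $X\to X$ under composition. A submonoid of $\mathcal{O}^{(1)}$ is a subset containing the identity and closed under composition; a maximal submonoid is a dual atom of the lattice of submonoids of $\mathcal{O}^{(1)}$ ordered by inclusion. $2\,|\alpha|+5$ is computed in cardinal arithmetic. *)

theory Defs
  imports "HOL-Algebra.Bij"
begin

unbundle cardinal_syntax

section \<open>Alephs\<close>

text \<open>
  \<open>Y\<close> has the least infinite cardinality that is larger than the cardinality of each member
  of \<open>C\<close>. It suffices to compare with sets \<open>W\<close> over the type of \<open>Y\<close>: a set over any other type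
  which is of smaller cardinality than \<open>Y\<close> is equipotent to a subset of \<open>Y\<close>.
\<close>

definition least_infinite_above :: "'a set set \<Rightarrow> 'a set \<Rightarrow> bool" where
  "least_infinite_above C Y \<longleftrightarrow>
     infinite Y \<and> (\<forall>Z\<in>C. |Z| <o |Y| ) \<and>
     (\<forall>W :: 'a set. infinite W \<and> (\<forall>Z\<in>C. |Z| <o |W| ) \<longrightarrow> |Y| \<le>o |W| )"

text \<open>
  An ordinal is given by a well-order \<open>\<alpha>\<close> representing it; the ordinals below it correspond to
  the elements of \<open>Field \<alpha>\<close>, so its cardinality is \<open>|Field \<alpha>|\<close>. The predicate
  \<open>has_card_aleph X \<alpha>\<close> says that \<open>X\<close> has cardinality \<open>\<aleph>\<^sub>\<alpha>\<close>, by the recursion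
  ``\<open>\<aleph>\<^sub>\<alpha>\<close> is the least infinite cardinal larger than all \<open>\<aleph>\<^sub>\<beta>\<close> with \<open>\<beta> < \<alpha>\<close>''. The set \<open>s b\<close>
  is of cardinality \<open>\<aleph>\<^sub>\<beta>\<close>, where \<open>\<beta>\<close> is the order type of \<open>underS \<alpha> b\<close>.
\<close>

definition has_card_aleph :: "'a set \<Rightarrow> 'b rel \<Rightarrow> bool" where
  "has_card_aleph X \<alpha> \<longleftrightarrow>
     Well_order \<alpha> \<and>
     (\<exists>s :: 'b \<Rightarrow> 'a set.
        (\<forall>b\<in>Field \<alpha>. least_infinite_above (s ` underS \<alpha> b) (s b)) \<and>
        least_infinite_above (s ` Field \<alpha>) X)"

section \<open>Maximal submonoids of the full transformation monoid\<close>

text \<open>As for \<^const>\<open>BijGroup\<close>, functions on \<open>X\<close> are represented by extensional ones.\<close>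

definition transformation_monoid :: "'a set \<Rightarrow> ('a \<Rightarrow> 'a) monoid" where
  "transformation_monoid X =
     \<lparr>carrier = X \<rightarrow>\<^sub>E X, mult = compose X, one = (\<lambda>x\<in>X. x)\<rparr>"

definition maximal_submonoid :: "'a set \<Rightarrow> ('a, 'b) monoid_scheme \<Rightarrow> bool" where
  "maximal_submonoid H G \<longleftrightarrow>
     submonoid H G \<and> H \<noteq> carrier G \<and>
     (\<forall>K. submonoid K G \<and> H \<subseteq> K \<longrightarrow> K = H \<or> K = carrier G)"

definition maximal_submonoids_above_perms :: "'a set \<Rightarrow> ('a \<Rightarrow> 'a) set set" where
  "maximal_submonoids_above_perms X =
     {H. maximal_submonoid H (transformation_monoid X) \<and> Bij X \<subseteq> H}"

end

theory Submission
  imports Defs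
begin

text \<open>
  A function \<open>f\<close> on \<open>X\<close> is determined up to permutations on both sides by the sizes of its
  fibres. Its collapse is the complement of a transversal of the fibres, its defect the complement
  of the range. The maximal submonoids above the permutations are, for \<open>\<lambda> = 1\<close> and every infinite
  \<open>\<lambda> \<le> |X|\<close>, the functions with collapse \<open>< \<lambda>\<close> or defect \<open>\<ge> \<lambda>\<close>, dually those with
  defect \<open>< \<lambda>\<close> or collapse \<open>\<ge> \<lambda>\<close>, and one more monoid consisting of the functions whose
  fibres are almost all small.

  If \<open>M\<close> lies in none of them, induction on \<open>\<lambda>\<close> yields in \<open>M\<close> an injection with defect \<open>|X|\<close>
  (choose a function violating the dual condition for \<open>\<lambda>\<close> and precompose it with an injection
  avoiding its collapse) and, dually, a surjection with collapse \<open>|X|\<close>. Together with a function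
  that has many large fibres these give a \<open>u \<in> M\<close> all of whose fibres have size \<open>|X|\<close>, and every
  function is \<open>u\<close> composed with an injection of defect \<open>|X|\<close>. As the listed monoids are pairwise
  incomparable, they are exactly the maximal ones.
\<close>

section \<open>Cardinalities of subsets\<close>

lemma not_card_less_iff: "\<not> |A| <o |B| \<longleftrightarrow> |B| \<le>o |A|"
  by (rule not_ordLess_iff_ordLeq[OF card_of_Well_order card_of_Well_order])

lemma not_card_le_iff: "\<not> |A| \<le>o |B| \<longleftrightarrow> |B| <o |A|"
  by (rule not_ordLeq_iff_ordLess[OF card_of_Well_order card_of_Well_order])

lemma card_le_antisym: "|A| \<le>o |B| \<Longrightarrow> |B| \<le>o |A| \<Longrightarrow> |A| =o |B|"
  by (simp add: ordIso_iff_ordLeq)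

lemma card_le_subset: "A \<subseteq> B \<Longrightarrow> |A| \<le>o |B|"
  by (rule card_of_mono1)

lemma card_le_subset_trans: "|A| \<le>o |B| \<Longrightarrow> B \<subseteq> C \<Longrightarrow> |A| \<le>o |C|"
  using ordLeq_transitive[OF _ card_le_subset] .

lemma subset_card_less: "A \<subseteq> B \<Longrightarrow> |B| <o |C| \<Longrightarrow> |A| <o |C|"
  using card_of_mono1 ordLeq_ordLess_trans by blast

lemma image_card_less: "|A| <o |C| \<Longrightarrow> |f ` A| <o |C|"
  using card_of_image ordLeq_ordLess_trans by blast

lemma card_le_inj_on: "inj_on f A \<Longrightarrow> f ` A \<subseteq> B \<Longrightarrow> |A| \<le>o |B|"
  using card_of_ordLeq by blast

lemma card_eq_inj_image: "inj_on f A \<Longrightarrow> |A| =o |f ` A|"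
  using card_of_ordIso[of A "f ` A"] inj_on_imp_bij_betw by blast

lemma finite_card_less_infinite: "finite A \<Longrightarrow> infinite B \<Longrightarrow> |A| <o |B|"
  by (rule finite_ordLess_infinite[OF card_of_Well_order card_of_Well_order]) (simp_all add: Field_card_of)

lemma card_Diff_less:
  assumes "infinite X" "|A| <o |X|"
  shows "|X - A| =o |X|"
proof -
  have "|X - A| <o |X| \<Longrightarrow> |(X - A) \<union> A| <o |X|"
    using assms card_of_Un_ordLess_infinite by blast
  moreover have "|X| \<le>o |(X - A) \<union> A|"
    by (rule card_le_subset) auto
  ultimately have "\<not> |X - A| <o |X|"
    using not_card_less_iff by blast
  then show ?thesis
    by (meson Diff_subset card_le_antisym card_le_subset not_card_less_iff)
qed

lemma subset_of_cardinality:
  assumes "|P| \<le>o |A|"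
  obtains B where "B \<subseteq> A" "|B| =o |P|"
  using assms ordIso_symmetric by (auto simp: internalize_card_of_ordLeq2[of P A])

lemma infinite_halves:
  assumes "infinite X"
  obtains A where "A \<subseteq> X" "|A| =o |X|" "|X - A| =o |X|"
proof -
  have "|X <+> X| =o |X|"
    using assms card_of_Plus_infinite1 ordLeq_reflexive card_of_Well_order by blast
  then obtain f where f: "bij_betw f (X <+> X) X"
    using card_of_ordIso by blast
  have inj: "inj_on f (X <+> X)" and im: "f ` (X <+> X) = X"
    using f by (auto simp: bij_betw_def)
  define l r where "l = f \<circ> Inl" and "r = f \<circ> Inr"
  have mem: "f u \<in> X" if "u \<in> X <+> X" for u
    using im that by blast
  have l: "inj_on l X" "l ` X \<subseteq> X" and r: "inj_on r X" "r ` X \<subseteq> X" and "l ` X \<inter> r ` X = {}"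
    by (auto simp: l_def r_def inj_on_def intro!: mem dest!: inj_onD[OF inj])
  then have "|X| \<le>o |X - l ` X|"
    by (intro card_le_inj_on[OF r(1)]) auto
  then have "|X - l ` X| =o |X|"
    by (simp add: card_le_antisym card_le_subset)
  moreover have "|l ` X| =o |X|"
    using card_eq_inj_image[OF l(1)] by (rule ordIso_symmetric)
  ultimately show thesis
    using that l(2) by blast
qed

lemma subset_of_cardinality_coinfinite:
  assumes "infinite X" "|P| \<le>o |X|"
  obtains B where "B \<subseteq> X" "|B| =o |P|" "|X - B| =o |X|"
proof -
  obtain A where A: "A \<subseteq> X" "|A| =o |X|" "|X - A| =o |X|"
    using infinite_halves assms(1) .
  have "|P| \<le>o |A|"
    using A(2) assms(2) ordIso_symmetric ordLeq_ordIso_trans by blast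
  then obtain B where B: "B \<subseteq> A" "|B| =o |P|"
    by (rule subset_of_cardinality)
  have "|X - A| \<le>o |X - B|"
    using B(1) by (intro card_le_subset) auto
  then have "|X| \<le>o |X - B|"
    using A(3) ordIso_ordLeq_trans ordIso_symmetric by blast
  then have "|X - B| =o |X|"
    by (simp add: card_le_antisym card_le_subset)
  then show thesis
    using that A B by blast
qed

section \<open>Permutations\<close>

lemma bij_betw_extend:
  assumes f: "bij_betw f A B" and sub: "A \<subseteq> X" "B \<subseteq> X" and card: "|X - A| =o |X - B|"
  obtains p where "p \<in> Bij X" "\<And>x. x \<in> A \<Longrightarrow> p x = f x"
proof -
  obtain g where g: "bij_betw g (X - A) (X - B)"
    using card card_of_ordIso by blast
  define p where "p = (\<lambda>x\<in>X. if x \<in> A then f x else g x)"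
  have "bij_betw p (A \<union> (X - A)) (B \<union> (X - B))"
  proof (rule bij_betw_combine)
    show "bij_betw p A B"
      using f sub by (subst bij_betw_cong[of _ _ f]) (auto simp: p_def)
    show "bij_betw p (X - A) (X - B)"
      using g by (subst bij_betw_cong[of _ _ g]) (auto simp: p_def)
  qed auto
  moreover have "A \<union> (X - A) = X" "B \<union> (X - B) = X" using sub by auto
  ultimately have "p \<in> Bij X"
    by (auto simp: Bij_def p_def)
  then show thesis
    by (rule that) (use sub in \<open>auto simp: p_def\<close>)
qed

lemma Bij_move_small_into:
  assumes "infinite X" "A \<subseteq> X" "B \<subseteq> X" "|A| <o |X|" "|A| \<le>o |B|"
  obtains p where "p \<in> Bij X" "p ` A \<subseteq> B"
proof -
  obtain B' where B': "B' \<subseteq> B" "|B'| =o |A|"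
    using subset_of_cardinality[OF assms(5)] .
  obtain f where f: "bij_betw f A B'"
    using B'(2) card_of_ordIso ordIso_symmetric by blast
  have "|B'| <o |X|"
    using B'(2) assms(4) ordIso_ordLess_trans by blast
  then have "|X - A| =o |X - B'|"
    using assms card_Diff_less ordIso_symmetric ordIso_transitive by meson
  then obtain p where "p \<in> Bij X" "\<And>x. x \<in> A \<Longrightarrow> p x = f x"
    using bij_betw_extend[OF f] assms B' by blast
  then show thesis
    using that f B'(1) by (auto simp: bij_betw_def)
qed

text \<open>Up to a permutation on the left, an injection is determined by the size of its defect.
  Hence one injection of defect \<open>|X|\<close> in a monoid above the permutations yields all of
  them.\<close>

lemma Bij_agreeing:
  assumes "inj_on h X" "h ` X \<subseteq> X" "inj_on j X" "j ` X \<subseteq> X" "|X - h ` X| =o |X - j ` X|"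
  obtains p where "p \<in> Bij X" "\<And>x. x \<in> X \<Longrightarrow> p (h x) = j x"
proof -
  have "bij_betw (j \<circ> inv_into X h) (h ` X) (j ` X)"
    using assms by (intro bij_betw_trans[of _ _ X] bij_betw_inv_into inj_on_imp_bij_betw)
  then obtain p where p: "p \<in> Bij X" "\<And>x. x \<in> h ` X \<Longrightarrow> p x = (j \<circ> inv_into X h) x"
    using bij_betw_extend[OF _ assms(2,4,5)] by blast
  then have "p (h x) = j x" if "x \<in> X" for x
    using that assms(1) by simp
  then show thesis using that p(1) by blast
qed

section \<open>Collapse and defect\<close>

text \<open>The transversal is the one chosen by \<open>inv_into\<close>. Another choice gives
  another set of the same size, and only the size enters the classification.\<close>

definition collapse :: "'a set \<Rightarrow> ('a \<Rightarrow> 'a) \<Rightarrow> 'a set" where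
  "collapse X f = X - inv_into X f ` f ` X"

definition defect :: "'a set \<Rightarrow> ('a \<Rightarrow> 'a) \<Rightarrow> 'a set" where
  "defect X f = X - f ` X"

lemma collapse_subset: "collapse X f \<subseteq> X"
  by (auto simp: collapse_def)

lemma defect_subset: "defect X f \<subseteq> X"
  by (auto simp: defect_def)

lemma Diff_collapse: "X - collapse X f = inv_into X f ` f ` X"
  using inv_into_into[of _ f X] by (auto simp: collapse_def)

lemma inj_on_Diff_collapse: "inj_on f (X - collapse X f)"
  by (auto simp: Diff_collapse inj_on_def f_inv_into_f)

lemma image_Diff_collapse: "f ` (X - collapse X f) = f ` X"
proof -
  have "(\<lambda>y. f (inv_into X f y)) ` f ` X = (\<lambda>y. y) ` f ` X"
    by (rule image_cong) (auto simp: f_inv_into_f)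
  then show ?thesis
    unfolding Diff_collapse by (simp add: image_comp comp_def)
qed

text \<open>A point \<open>b\<close> of \<open>B\<close> outside \<open>A\<close> has a partner
  outside \<open>B\<close> with the same value, and this partner lies in \<open>A\<close> because
  \<open>f\<close> is injective off \<open>A\<close>. So \<open>|collapse X f|\<close> is both the
  least size of a set off which \<open>f\<close> is injective and the greatest size of a set
  removable without shrinking the range.\<close>

lemma card_redundant_le:
  assumes "B \<subseteq> X" "inj_on f (X - A)" "f ` (X - B) = f ` X"
  shows "|B| \<le>o |A|"
proof -
  have "\<exists>c. c \<in> X - B \<and> f c = f b" if "b \<in> B" for b
  proof -
    have "f b \<in> f ` (X - B)" using that assms by blast
    then show ?thesis by (auto simp del: Diff_iff)
  qed
  then obtain c where c: "\<And>b. b \<in> B \<Longrightarrow> c b \<in> X - B \<and> f (c b) = f b"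
    by metis
  \<comment> \<open>Fixed points stay in \<open>B\<close> and partners lie outside \<open>B\<close>,
    so the two cases cannot collide.\<close>
  define \<phi> where "\<phi> b = (if b \<in> A then b else c b)" for b
  have "c b \<in> A" if "b \<in> B" "b \<notin> A" for b
    by (rule ccontr) (use c[OF that(1)] that assms(1) inj_onD[OF assms(2), of "c b" b] in auto)
  then have "\<phi> ` B \<subseteq> A"
    by (auto simp: \<phi>_def)
  moreover have "inj_on \<phi> B"
  proof (rule inj_onI)
    fix x y assume xy: "x \<in> B" "y \<in> B" "\<phi> x = \<phi> y"
    show "x = y"
    proof (cases "x \<in> A \<or> y \<in> A")
      case True
      then show ?thesis
        using xy c[of x] c[of y] by (auto simp: \<phi>_def split: if_splits)
    next
      case False
      then have "f x = f y"
        using xy c[of x] c[of y] by (auto simp: \<phi>_def)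
      then show ?thesis
        using False xy assms inj_onD[OF assms(2), of x y] by auto
    qed
  qed
  ultimately show ?thesis
    by (rule card_le_inj_on[rotated])
qed

lemma card_collapse_le: "inj_on f (X - A) \<Longrightarrow> |collapse X f| \<le>o |A|"
  using card_redundant_le collapse_subset image_Diff_collapse by metis

lemma card_le_collapse: "B \<subseteq> X \<Longrightarrow> f ` (X - B) = f ` X \<Longrightarrow> |B| \<le>o |collapse X f|"
  using card_redundant_le inj_on_Diff_collapse by metis

lemma collapse_eq_empty: "inj_on f X \<Longrightarrow> collapse X f = {}"
  using card_collapse_le[of f X "{}"] card_of_empty3 by auto

lemma compose_in: "f \<in> X \<rightarrow>\<^sub>E X \<Longrightarrow> g \<in> X \<rightarrow>\<^sub>E X \<Longrightarrow> compose X f g \<in> X \<rightarrow>\<^sub>E X"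
  by (auto simp: compose_def)

lemma compose_image: "g ` X \<subseteq> X \<Longrightarrow> compose X f g ` X = f ` g ` X"
  by (auto simp: compose_def)

lemma defect_le_defect_compose:
  assumes "g \<in> X \<rightarrow>\<^sub>E X"
  shows "defect X f \<subseteq> defect X (compose X f g)"
  using assms by (auto simp: defect_def compose_def)

lemma collapse_le_collapse_compose: "|collapse X g| \<le>o |collapse X (compose X f g)|"
proof (rule card_collapse_le)
  show "inj_on g (X - collapse X (compose X f g))"
    using inj_on_Diff_collapse[of "compose X f g" X] by (auto simp: inj_on_def compose_def)
qed

section \<open>The maximal submonoids\<close>

text \<open>
  The sets \<open>L\<close> serve as cardinal numbers; \<open>near_injective X L\<close> and \<open>near_surjective X L\<close>
  depend only on the cardinality of \<open>L\<close>. The admissible thresholds are \<open>1\<close> and the infinite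
  cardinals: those \<open>\<lambda>\<close> for which a union of two sets of fewer than \<open>\<lambda>\<close> elements again has
  fewer than \<open>\<lambda>\<close> elements.
\<close>

definition threshold :: "'a set \<Rightarrow> bool" where
  "threshold L \<longleftrightarrow> infinite L \<or> (\<exists>x. L = {x})"

definition near_injective :: "'a set \<Rightarrow> 'a set \<Rightarrow> ('a \<Rightarrow> 'a) set" where
  "near_injective X L =
     {f \<in> X \<rightarrow>\<^sub>E X. |collapse X f| <o |L| \<or> |L| \<le>o |defect X f| }"

definition near_surjective :: "'a set \<Rightarrow> 'a set \<Rightarrow> ('a \<Rightarrow> 'a) set" where
  "near_surjective X L =
     {f \<in> X \<rightarrow>\<^sub>E X. |defect X f| <o |L| \<or> |L| \<le>o |collapse X f| }"

text \<open>
  For regular \<open>|X|\<close> the next condition says that fewer than \<open>|X|\<close> fibres of \<open>f\<close> have \<open>|X|\<close>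
  elements; for singular \<open>|X|\<close> it says that, for some \<open>\<mu> < |X|\<close>, fewer than \<open>|X|\<close> fibres of \<open>f\<close>
  have more than \<open>\<mu>\<close> elements.
\<close>

definition near_small_fibred :: "'a set \<Rightarrow> ('a \<Rightarrow> 'a) set" where
  "near_small_fibred X =
     {f \<in> X \<rightarrow>\<^sub>E X. \<exists>Z. |Z| <o |X| \<and>
        (\<forall>B. |B| <o |X| \<and> B \<inter> Z = {} \<longrightarrow> |{x \<in> X. f x \<in> B}| <o |X| )}"

lemma card_less_singleton_iff: "|A| <o |{x}| \<longleftrightarrow> A = {}"
proof -
  have "|{x}| \<le>o |A| \<longleftrightarrow> A \<noteq> {}"
    using card_of_singl_ordLeq[of A x] card_of_empty3[of "{x}"] by (cases "A = {}") auto
  then show ?thesis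
    by (metis not_card_le_iff)
qed

section \<open>Closure under composition\<close>

lemma threshold_Un:
  "threshold L \<Longrightarrow> |A| <o |L| \<Longrightarrow> |B| <o |L| \<Longrightarrow> |A \<union> B| <o |L|"
  unfolding threshold_def by (auto simp: card_less_singleton_iff intro: card_of_Un_ordLess_infinite)

lemma threshold_empty: "threshold L \<Longrightarrow> |{}| <o |L|"
  by (auto simp: threshold_def card_less_singleton_iff intro: finite_card_less_infinite)

lemma collapse_compose_less:
  assumes L: "threshold L" and g: "g \<in> X \<rightarrow>\<^sub>E X"
    and "|collapse X f| <o |L|" "|collapse X g| <o |L|"
  shows "|collapse X (compose X f g)| <o |L|"
proof -
  \<comment> \<open>\<open>g\<close> is injective off its own collapse, so this part of the preimage
    of \<open>collapse X f\<close> is no larger than \<open>collapse X f\<close>.\<close>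
  define A where "A = {x \<in> X - collapse X g. g x \<in> collapse X f}"
  have "inj_on g A"
    using inj_on_Diff_collapse[of g X] by (rule inj_on_subset) (auto simp: A_def)
  then have "|A| \<le>o |collapse X f|"
    by (rule card_le_inj_on) (auto simp: A_def)
  then have "|A| <o |L|"
    using assms(3) ordLeq_ordLess_trans by blast
  then have A: "|collapse X g \<union> A| <o |L|"
    using threshold_Un L assms(4) by blast
  have "inj_on (compose X f g) (X - (collapse X g \<union> A))"
  proof (rule inj_onI)
    fix x y
    assume xy: "x \<in> X - (collapse X g \<union> A)" "y \<in> X - (collapse X g \<union> A)"
      "compose X f g x = compose X f g y"
    then have "f (g x) = f (g y)" by (auto simp: compose_def)
    moreover have "g x \<in> X - collapse X f" "g y \<in> X - collapse X f"
      using xy g by (auto simp: A_def)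
    ultimately have "g x = g y"
      using inj_onD[OF inj_on_Diff_collapse] by metis
    then show "x = y"
      using inj_onD[OF inj_on_Diff_collapse] xy by (metis DiffD1 DiffD2 DiffI UnI1)
  qed
  then have "|collapse X (compose X f g)| \<le>o |collapse X g \<union> A|"
    by (rule card_collapse_le)
  then show ?thesis
    using A ordLeq_ordLess_trans by blast
qed

lemma defect_compose_less:
  assumes L: "threshold L" and "|defect X f| <o |L|" "|defect X g| <o |L|"
  shows "|defect X (compose X f g)| <o |L|"
proof -
  have "defect X (compose X f g) \<subseteq> defect X f \<union> f ` defect X g"
    by (auto simp: defect_def compose_def)
  moreover have "|defect X f \<union> f ` defect X g| <o |L|"
    using threshold_Un[OF L] image_card_less assms by blast
  ultimately show ?thesis
    by (rule subset_card_less)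
qed

text \<open>If the composite has defect below \<open>|L|\<close>, then so has \<open>f\<close>,
  whose collapse is therefore small too. This forces first the defect and then the collapse of
  \<open>g\<close> below \<open>|L|\<close>.\<close>

lemma near_injective_compose:
  assumes L: "threshold L" and f: "f \<in> near_injective X L" and g: "g \<in> near_injective X L"
  shows "compose X f g \<in> near_injective X L"
proof (cases "|defect X (compose X f g)| <o |L|")
  case False
  then show ?thesis
    using f g compose_in by (auto simp: near_injective_def not_card_less_iff)
next
  case True
  let ?h = "compose X f g"
  have fX: "f \<in> X \<rightarrow>\<^sub>E X" and gX: "g \<in> X \<rightarrow>\<^sub>E X"
    using f g by (auto simp: near_injective_def)
  have "|defect X f| <o |L|"
    using defect_le_defect_compose[OF gX] True by (rule subset_card_less)
  then have Cf: "|collapse X f| <o |L|"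
    using f by (auto simp: near_injective_def not_card_less_iff[symmetric])
  \<comment> \<open>If the value of a point \<open>z\<close> missed by \<open>g\<close> is attained
    by the composite, it equals the value of some \<open>g u\<close> different from
    \<open>z\<close>. As \<open>f\<close> is injective off its collapse, \<open>g u\<close> lies in
    the collapse.\<close>
  have "f ` (defect X g - collapse X f) \<subseteq> defect X ?h \<union> f ` collapse X f"
  proof (rule image_subsetI)
    fix z assume z: "z \<in> defect X g - collapse X f"
    show "f z \<in> defect X ?h \<union> f ` collapse X f"
    proof (cases "f z \<in> ?h ` X")
      case True
      then obtain u where u: "u \<in> X" "f z = f (g u)"
        by (auto simp: compose_def)
      then have "g u \<noteq> z" "g u \<in> X" "z \<in> X"
        using z gX by (auto simp: defect_def)
      then have "g u \<in> collapse X f"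
        using inj_onD[OF inj_on_Diff_collapse[of f X] u(2)] z by auto
      then show ?thesis using u by auto
    next
      case False
      then show ?thesis using z fX by (auto simp: defect_def)
    qed
  qed
  moreover have "inj_on f (defect X g - collapse X f)"
    using inj_on_Diff_collapse[of f X] by (rule inj_on_subset) (auto simp: defect_def)
  ultimately have "|defect X g - collapse X f| \<le>o |defect X ?h \<union> f ` collapse X f|"
    by (rule card_le_inj_on[rotated])
  moreover have "|defect X ?h \<union> f ` collapse X f| <o |L|"
    using threshold_Un[OF L True] image_card_less Cf by blast
  ultimately have "|defect X g - collapse X f| <o |L|"
    using ordLeq_ordLess_trans by blast
  then have "|(defect X g - collapse X f) \<union> collapse X f| <o |L|"
    using threshold_Un[OF L] Cf by blast
  then have "|defect X g| <o |L|"
    by (rule subset_card_less[rotated]) auto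
  then have "|collapse X g| <o |L|"
    using g by (auto simp: near_injective_def not_card_less_iff[symmetric])
  then show ?thesis
    using collapse_compose_less[OF L gX Cf] compose_in[OF fX gX]
    by (auto simp: near_injective_def)
qed

text \<open>The dual argument runs from the inner function outwards: a small collapse of the
  composite bounds the collapse of \<open>g\<close>, hence its defect, then the collapse of
  \<open>f\<close>, hence its defect.\<close>

lemma near_surjective_compose:
  assumes L: "threshold L" and f: "f \<in> near_surjective X L" and g: "g \<in> near_surjective X L"
  shows "compose X f g \<in> near_surjective X L"
proof (cases "|collapse X (compose X f g)| <o |L|")
  case False
  then show ?thesis
    using f g compose_in by (auto simp: near_surjective_def not_card_less_iff)
next
  case True
  let ?h = "compose X f g"
  have fX: "f \<in> X \<rightarrow>\<^sub>E X" and gX: "g \<in> X \<rightarrow>\<^sub>E X"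
    using f g by (auto simp: near_surjective_def)
  have "|collapse X g| <o |L|"
    using collapse_le_collapse_compose True ordLeq_ordLess_trans by blast
  then have Dg: "|defect X g| <o |L|"
    using g by (auto simp: near_surjective_def not_card_less_iff[symmetric])
  have "inj_on f (X - (defect X g \<union> g ` collapse X ?h))"
  proof (rule inj_onI)
    fix x y
    assume xy: "x \<in> X - (defect X g \<union> g ` collapse X ?h)"
      "y \<in> X - (defect X g \<union> g ` collapse X ?h)" "f x = f y"
    then obtain u v where uv: "u \<in> X" "v \<in> X" "x = g u" "y = g v"
      by (auto simp: defect_def)
    then have "u \<in> X - collapse X ?h" "v \<in> X - collapse X ?h" "?h u = ?h v"
      using xy by (auto simp: compose_def)
    then show "x = y"
      using inj_onD[OF inj_on_Diff_collapse] uv by metis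
  qed
  then have "|collapse X f| \<le>o |defect X g \<union> g ` collapse X ?h|"
    by (rule card_collapse_le)
  moreover have "|defect X g \<union> g ` collapse X ?h| <o |L|"
    using threshold_Un[OF L Dg] image_card_less True by blast
  ultimately have "|collapse X f| <o |L|"
    using ordLeq_ordLess_trans by blast
  then have "|defect X f| <o |L|"
    using f by (auto simp: near_surjective_def not_card_less_iff[symmetric])
  then show ?thesis
    using defect_compose_less[OF L _ Dg] compose_in[OF fX gX]
    by (auto simp: near_surjective_def)
qed

text \<open>The union of \<open>S\<close> with the image of \<open>T\<close> under \<open>f\<close>
  is the exceptional set: a small \<open>B\<close> avoiding it has a small preimage under
  \<open>f\<close>, which avoids \<open>T\<close> and so has a small preimage under
  \<open>g\<close>.\<close>

lemma near_small_fibred_compose: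
  assumes X: "infinite X" and f: "f \<in> near_small_fibred X" and g: "g \<in> near_small_fibred X"
  shows "compose X f g \<in> near_small_fibred X"
proof -
  have fX: "f \<in> X \<rightarrow>\<^sub>E X" and gX: "g \<in> X \<rightarrow>\<^sub>E X"
    using f g by (auto simp: near_small_fibred_def)
  obtain S where S: "|S| <o |X|"
    "\<And>B. |B| <o |X| \<Longrightarrow> B \<inter> S = {} \<Longrightarrow> |{x \<in> X. f x \<in> B}| <o |X|"
    using f by (auto simp: near_small_fibred_def)
  obtain T where T: "|T| <o |X|"
    "\<And>B. |B| <o |X| \<Longrightarrow> B \<inter> T = {} \<Longrightarrow> |{x \<in> X. g x \<in> B}| <o |X|"
    using g by (auto simp: near_small_fibred_def)
  have "|S \<union> f ` T| <o |X|"
    using card_of_Un_ordLess_infinite[OF X S(1)] image_card_less T(1) by blast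
  moreover have "|{x \<in> X. compose X f g x \<in> B}| <o |X|"
    if B: "|B| <o |X|" "B \<inter> (S \<union> f ` T) = {}" for B
  proof -
    have "|{x \<in> X. f x \<in> B}| <o |X|"
      using B by (intro S(2)) auto
    then have "|{x \<in> X. g x \<in> {x \<in> X. f x \<in> B}}| <o |X|"
      using B by (intro T(2)) auto
    then show ?thesis
      by (rule subset_card_less[rotated]) (use gX in \<open>auto simp: compose_def\<close>)
  qed
  ultimately show ?thesis
    using compose_in[OF fX gX] unfolding near_small_fibred_def by blast
qed

lemma Bij_in: "p \<in> Bij X \<Longrightarrow> p \<in> X \<rightarrow>\<^sub>E X"
  by (auto simp: PiE_def intro: Bij_imp_extensional dest: Bij_imp_funcset)

lemma Bij_inj_on: "p \<in> Bij X \<Longrightarrow> inj_on p X"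
  by (auto simp: Bij_def bij_betw_def)

lemma Bij_image: "p \<in> Bij X \<Longrightarrow> p ` X = X"
  by (auto simp: Bij_def bij_betw_def)

lemma Bij_subset_near_injective: "threshold L \<Longrightarrow> Bij X \<subseteq> near_injective X L"
  by (auto simp: near_injective_def collapse_eq_empty Bij_inj_on threshold_empty dest: Bij_in)

lemma Bij_subset_near_surjective: "threshold L \<Longrightarrow> Bij X \<subseteq> near_surjective X L"
  by (auto simp: near_surjective_def defect_def Bij_image threshold_empty dest: Bij_in)

lemma card_vimage_inj_on_less:
  assumes "inj_on f A" "|B| <o |X|"
  shows "|{x \<in> A. f x \<in> B}| <o |X|"
proof -
  have "|{x \<in> A. f x \<in> B}| \<le>o |B|"
    using assms(1) by (intro card_le_inj_on[of f]) (auto simp: inj_on_def)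
  then show ?thesis
    using assms(2) ordLeq_ordLess_trans by blast
qed

lemma Bij_subset_near_small_fibred: "infinite X \<Longrightarrow> Bij X \<subseteq> near_small_fibred X"
  unfolding near_small_fibred_def
  by (auto intro!: exI[of _ "{}"] card_vimage_inj_on_less Bij_inj_on Bij_in
      intro: finite_card_less_infinite[of "{}"])

lemma submonoid_transformation_monoidI:
  assumes "H \<subseteq> X \<rightarrow>\<^sub>E X" "Bij X \<subseteq> H"
    and "\<And>f g. f \<in> H \<Longrightarrow> g \<in> H \<Longrightarrow> compose X f g \<in> H"
  shows "submonoid H (transformation_monoid X)"
  using assms id_Bij[of X] by unfold_locales (auto simp: transformation_monoid_def)

lemma submonoid_near_injective:
  "threshold L \<Longrightarrow> submonoid (near_injective X L) (transformation_monoid X)"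
  by (intro submonoid_transformation_monoidI Bij_subset_near_injective near_injective_compose)
    (auto simp: near_injective_def)

lemma submonoid_near_surjective:
  "threshold L \<Longrightarrow> submonoid (near_surjective X L) (transformation_monoid X)"
  by (intro submonoid_transformation_monoidI Bij_subset_near_surjective near_surjective_compose)
    (auto simp: near_surjective_def)

lemma submonoid_near_small_fibred:
  "infinite X \<Longrightarrow> submonoid (near_small_fibred X) (transformation_monoid X)"
  by (intro submonoid_transformation_monoidI Bij_subset_near_small_fibred near_small_fibred_compose)
    (auto simp: near_small_fibred_def)

section \<open>Completeness\<close>

lemma card_le_insert:
  assumes "|C| \<le>o |D|" "y \<notin> D"
  shows "|insert x C| \<le>o |insert y D|"
proof -
  obtain f where f: "inj_on f C" "f ` C \<subseteq> D"
    using assms(1) card_of_ordLeq by metis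
  then have "inj_on (f(x := y)) (insert x C)" "(f(x := y)) ` insert x C \<subseteq> insert y D"
    using assms(2) by (auto simp: inj_on_def)
  then show ?thesis
    by (rule card_le_inj_on)
qed

text \<open>The property climbs from \<open>{}\<close> to singletons, by insertion to all finite
  sets, and through the infinite cardinals by well-founded induction. At each threshold
  \<open>step\<close> may choose the smaller set from which to continue.\<close>

lemma threshold_induct:
  assumes empty: "Q {}"
    and insert: "\<And>x C. finite C \<Longrightarrow> Q C \<Longrightarrow> Q {x} \<Longrightarrow> Q (insert x C)"
    and step: "\<And>L. threshold L \<Longrightarrow> |L| \<le>o |X| \<Longrightarrow> \<exists>C. |C| <o |L| \<and> (Q C \<longrightarrow> Q L)"
    and X: "infinite X" "|L| \<le>o |X|"
  shows "Q L"
proof -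
  have single: "Q {x}" for x
  proof -
    have "|{x}| \<le>o |X|"
      using finite_card_less_infinite[OF _ X(1)] ordLess_imp_ordLeq by blast
    then obtain C where "|C| <o |{x}|" "Q C \<longrightarrow> Q {x}"
      using step[of "{x}"] by (auto simp: threshold_def)
    then show ?thesis
      using empty by (simp add: card_less_singleton_iff)
  qed
  have fin: "Q C" if "finite C" for C
    using that by (induction rule: finite_induct) (use empty insert single in auto)
  have "|L| \<le>o |X| \<longrightarrow> Q L"
  proof (induction L rule: wf_induct[OF wf_inv_image[OF wf_ordLess, of card_of]])
    case (1 L)
    show ?case
    proof (cases "finite L")
      case False
      show ?thesis
      proof
        assume L: "|L| \<le>o |X|"
        then obtain C where C: "|C| <o |L|" "Q C \<longrightarrow> Q L"
          using step[of L] False by (auto simp: threshold_def)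
        then have "|C| \<le>o |X|"
          using L ordLess_ordLeq_trans ordLess_imp_ordLeq by blast
        then show "Q L"
          using 1 C by (auto simp: in_inv_image)
      qed
    qed (simp add: fin)
  qed
  then show ?thesis
    using X(2) by blast
qed

text \<open>If a factor is infinite, the sum \<open>?V\<close> of both is equipotent to its square,
  which bounds the product.\<close>

lemma card_Times_less:
  assumes X: "infinite X" and "|A| <o |X|" "|B| <o |X|"
  shows "|A \<times> B| <o |X|"
proof (cases "finite A \<and> finite B")
  case True
  then show ?thesis
    by (intro finite_card_less_infinite[OF _ X]) auto
next
  case False
  let ?V = "(A <+> B)"
  have V: "infinite ?V"
    using False by auto
  have "|A \<times> B| \<le>o |?V \<times> B|"
    by (intro card_of_Times_mono1 card_of_Plus1)
  also have "|?V \<times> B| \<le>o |?V \<times> ?V|"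
    by (intro card_of_Times_mono2 card_of_Plus2)
  also have "|?V \<times> ?V| =o |?V|"
    using V by (rule card_of_Times_same_infinite)
  also have "|?V| <o |X|"
    using card_of_Plus_ordLess_infinite assms by blast
  finally show ?thesis .
qed

lemma card_UNION_le_Times:
  assumes "\<And>b. b \<in> B \<Longrightarrow> |F b| \<le>o |K|"
  shows "|\<Union>b\<in>B. F b| \<le>o |B \<times> K|"
  using card_of_UNION_Sigma card_of_Sigma_mono1[of B F "\<lambda>_. K"] assms ordLeq_transitive
  by (metis (no_types, lifting))

text \<open>Such an \<open>M\<close> is a submonoid above the permutations contained in none of the
  listed monoids; the goal is that it contains every function. Each negative assumption supplies a
  member of \<open>M\<close> violating one of the conditions.\<close>

locale complete_monoid =
  fixes X :: "'a set" and M :: "('a \<Rightarrow> 'a) set"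
  assumes infinite_X: "infinite X"
    and M_subset: "M \<subseteq> X \<rightarrow>\<^sub>E X"
    and Bij_subset: "Bij X \<subseteq> M"
    and M_closed: "f \<in> M \<Longrightarrow> g \<in> M \<Longrightarrow> compose X f g \<in> M"
    and not_near_injective: "threshold L \<Longrightarrow> |L| \<le>o |X| \<Longrightarrow> \<not> M \<subseteq> near_injective X L"
    and not_near_surjective: "threshold L \<Longrightarrow> |L| \<le>o |X| \<Longrightarrow> \<not> M \<subseteq> near_surjective X L"
    and not_near_small_fibred: "\<not> M \<subseteq> near_small_fibred X"
begin

section \<open>Injections of large defect and surjections of large collapse\<close>

lemma M_image: "f \<in> M \<Longrightarrow> f ` X \<subseteq> X"
  using M_subset by auto

lemma id_in_M: "(\<lambda>x\<in>X. x) \<in> M"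
  using Bij_subset id_Bij by blast

lemma injection_of_large_defect: "\<exists>h\<in>M. inj_on h X \<and> |X - h ` X| =o |X|"
proof -
  define Q where "Q C \<longleftrightarrow> (\<exists>h\<in>M. inj_on h X \<and> |C| \<le>o |X - h ` X| )" for C :: "'a set"
  have "Q X"
  proof (rule threshold_induct[of Q])
    show "Q {}"
      unfolding Q_def using id_in_M by (auto intro!: bexI[of _ "\<lambda>x\<in>X. x"] simp: inj_on_def card_of_empty)
  next
    fix x C
    assume "Q C" "Q {x}"
    then obtain h i where h: "h \<in> M" "inj_on h X" "|C| \<le>o |X - h ` X|"
      and i: "i \<in> M" "inj_on i X" "|{x}| \<le>o |X - i ` X|"
      unfolding Q_def by blast
    \<comment> \<open>Precomposing \<open>h\<close> with \<open>i\<close> loses one more point,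
      namely \<open>h z\<close>.\<close>
    obtain z where z: "z \<in> X - i ` X"
      using i(3) card_of_empty3[of "{x}"] by (cases "X - i ` X = {}") auto
    have "|insert x C| \<le>o |insert (h z) (X - h ` X)|"
      using h(3) z by (intro card_le_insert) auto
    moreover have "insert (h z) (X - h ` X) \<subseteq> X - compose X h i ` X"
      using z M_image[OF h(1)] M_image[OF i(1)] inj_onD[OF h(2), of z]
      by (auto simp: compose_def)
    ultimately have "|insert x C| \<le>o |X - compose X h i ` X|"
      by (rule card_le_subset_trans)
    moreover have "inj_on (compose X h i) X"
      using comp_inj_on[OF i(2) inj_on_subset[OF h(2) M_image[OF i(1)]]]
      by (simp add: inj_on_def compose_def)
    ultimately show "Q (insert x C)"
      unfolding Q_def using M_closed[OF h(1) i(1)] by blast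
  next
    fix L :: "'a set"
    assume L: "threshold L" "|L| \<le>o |X|"
    \<comment> \<open>A violator of the dual condition has defect at least \<open>|L|\<close> and a
      collapse below \<open>|L|\<close>, to which the induction hypothesis will be applied.\<close>
    obtain f where f: "f \<in> M" "f \<notin> near_surjective X L"
      using not_near_surjective[OF L] by blast
    then have Df: "|L| \<le>o |defect X f|" and Cf: "|collapse X f| <o |L|"
      using M_subset by (auto simp: near_surjective_def not_card_less_iff not_card_le_iff)
    have "Q L" if "Q (collapse X f)"
    proof -
      obtain h where h: "h \<in> M" "inj_on h X" "|collapse X f| \<le>o |X - h ` X|"
        using \<open>Q (collapse X f)\<close> unfolding Q_def by blast
      have "|collapse X f| <o |X|"
        using Cf L(2) ordLess_ordLeq_trans by blast
      then obtain p where p: "p \<in> Bij X" "p ` collapse X f \<subseteq> X - h ` X"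
        using Bij_move_small_into[OF infinite_X collapse_subset _ _ h(3)] by auto
      \<comment> \<open>The inverse \<open>r\<close> of \<open>p\<close> moves the range of
        \<open>h\<close> off the collapse of \<open>f\<close>, where \<open>f\<close> is injective;
        the defect of the composite still contains that of \<open>f\<close>.\<close>
      define r where "r = (\<lambda>x\<in>X. inv_into X p x)"
      have r: "r \<in> Bij X"
        unfolding r_def using p(1) by (rule restrict_inv_into_Bij)
      have pr: "p (r x) = x" if "x \<in> X" for x
        using that Bij_image[OF p(1)] by (auto simp: r_def f_inv_into_f)
      have hX: "h x \<in> X" "r (h x) \<in> X" if "x \<in> X" for x
        using M_image[OF h(1)] Bij_in[OF r] that by auto
      have avoid: "r (h x) \<in> X - collapse X f" if "x \<in> X" for x
        using p(2) pr[OF hX(1)[OF that]] hX[OF that] that by (metis DiffD2 DiffI image_eqI subsetD)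
      let ?k = "compose X f (compose X r h)"
      have "inj_on ?k X"
      proof (rule inj_onI)
        fix x y assume xy: "x \<in> X" "y \<in> X" "?k x = ?k y"
        then have "r (h x) = r (h y)"
          using inj_onD[OF inj_on_Diff_collapse[of f X]] avoid by (auto simp: compose_def)
        then show "x = y"
          using xy pr hX inj_onD[OF h(2)] by metis
      qed
      moreover have k: "?k \<in> M"
        using M_closed f(1) h(1) r Bij_subset by blast
      moreover have "defect X f \<subseteq> X - ?k ` X"
        using defect_le_defect_compose[of "compose X r h" X f] M_closed[OF _ h(1), of r] r
          Bij_subset M_subset by (auto simp: defect_def)
      then have "|L| \<le>o |X - ?k ` X|"
        by (rule card_le_subset_trans[OF Df])
      ultimately show "Q L"
        unfolding Q_def by blast
    qed
    then show "\<exists>C. |C| <o |L| \<and> (Q C \<longrightarrow> Q L)"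
      using Cf by blast
  qed (simp_all add: infinite_X card_le_subset)
  then show ?thesis
    unfolding Q_def using card_le_antisym card_le_subset[of "X - _" X] by (meson Diff_subset)
qed

text \<open>Dual to the previous induction: the points missed by a violator \<open>f\<close> are
  hidden among the redundant points of a surjection already found.\<close>

lemma surjection_of_large_collapse: "\<exists>s\<in>M. s ` X = X \<and> |collapse X s| =o |X|"
proof -
  define Q where "Q C \<longleftrightarrow> (\<exists>s\<in>M. s ` X = X \<and> |C| \<le>o |collapse X s| )" for C :: "'a set"
  have "Q X"
  proof (rule threshold_induct[of Q])
    show "Q {}"
      unfolding Q_def using id_in_M by (auto intro!: bexI[of _ "\<lambda>x\<in>X. x"] simp: card_of_empty)
  next
    fix x C
    assume "Q C" "Q {x}"
    then obtain s i where s: "s \<in> M" "s ` X = X" "|C| \<le>o |collapse X s|"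
      and i: "i \<in> M" "i ` X = X" "|{x}| \<le>o |collapse X i|"
      unfolding Q_def by blast
    obtain b where b: "b \<in> collapse X i"
      using i(3) card_of_empty3[of "{x}"] by (cases "collapse X i = {}") auto
    define g where "g = inv_into X i"
    have g: "g x \<in> X" "i (g x) = x" if "x \<in> X" for x
      using that i(2) by (auto simp: g_def inv_into_into f_inv_into_f)
    then have g_inj: "inj_on g X"
      by (metis inj_onI)
    have b': "b \<in> X" "b \<notin> g ` X"
      using b i(2) by (auto simp: collapse_def g_def)
    \<comment> \<open>The section \<open>g\<close> of \<open>i\<close> pulls redundant points of
      \<open>s\<close> back to redundant points of the composite; \<open>b\<close> is a further one,
      being outside the range of \<open>g\<close>.\<close>
    define B where "B = insert b (g ` collapse X s)"
    have "|collapse X s| =o |g ` collapse X s|"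
      by (rule card_eq_inj_image[OF inj_on_subset[OF g_inj collapse_subset]])
    with s(3) have "|C| \<le>o |g ` collapse X s|"
      by (rule ordLeq_ordIso_trans)
    then have "|insert x C| \<le>o |B|"
      unfolding B_def using b'(2) image_mono[OF collapse_subset, of g X s]
      by (intro card_le_insert) auto
    moreover have B: "B \<subseteq> X"
      using b' g collapse_subset[of X s] by (auto simp: B_def)
    have surj: "y \<in> compose X s i ` (X - B)" if y: "y \<in> X" for y
    proof -
      have "y \<in> s ` (X - collapse X s)"
        by (simp add: image_Diff_collapse s(2) y)
      then obtain x where x: "x \<in> X - collapse X s" "s x = y"
        by blast
      then have "g x \<in> X - B"
        using g b' inj_on_image_mem_iff[OF g_inj _ collapse_subset] by (auto simp: B_def)
      then show ?thesis
        using x g[of x] by (auto simp: compose_def intro!: image_eqI[of _ _ "g x"])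
    qed
    have k: "compose X s i \<in> M" "compose X s i ` X = X"
      using M_closed s i compose_image[of i X s] by auto
    have "compose X s i ` (X - B) = compose X s i ` X"
      using surj k(2) by blast
    then have "|B| \<le>o |collapse X (compose X s i)|"
      by (rule card_le_collapse[OF B])
    ultimately show "Q (insert x C)"
      unfolding Q_def using k ordLeq_transitive by blast
  next
    fix L :: "'a set"
    assume L: "threshold L" "|L| \<le>o |X|"
    obtain f where f: "f \<in> M" "f \<notin> near_injective X L"
      using not_near_injective[OF L] by blast
    then have Cf: "|L| \<le>o |collapse X f|" and Df: "|defect X f| <o |L|"
      using M_subset by (auto simp: near_injective_def not_card_less_iff not_card_le_iff)
    have "Q L" if "Q (defect X f)"
    proof -
      obtain s where s: "s \<in> M" "s ` X = X" "|defect X f| \<le>o |collapse X s|"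
        using \<open>Q (defect X f)\<close> unfolding Q_def by blast
      have "|defect X f| <o |X|"
        using Df L(2) ordLess_ordLeq_trans by blast
      \<comment> \<open>After \<open>p\<close> has moved the points missed by \<open>f\<close> into
        the collapse of \<open>s\<close>, the range of \<open>f\<close> still covers a full
        transversal of \<open>s\<close>, so the composite is surjective.\<close>
      then obtain p where p: "p \<in> Bij X" "p ` defect X f \<subseteq> collapse X s"
        using Bij_move_small_into[OF infinite_X defect_subset collapse_subset _ s(3)] by auto
      let ?k = "compose X (compose X s p) f"
      have k: "?k \<in> M"
        using M_closed s(1) f(1) p(1) Bij_subset by blast
      have "y \<in> ?k ` X" if y: "y \<in> X" for y
      proof -
        have "y \<in> s ` (X - collapse X s)"
          by (simp add: image_Diff_collapse s(2) y)
        then obtain x where x: "x \<in> X - collapse X s" "s x = y"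
          by blast
        then have "x \<in> p ` X"
          by (simp add: Bij_image[OF p(1)])
        then obtain z where z: "z \<in> X" "p z = x"
          by blast
        then have "z \<in> f ` X"
          using p(2) x by (auto simp: defect_def)
        then show ?thesis
          using x z by (auto simp: compose_def)
      qed
      then have "?k ` X = X"
        using M_image[OF k] by blast
      moreover have "|L| \<le>o |collapse X ?k|"
        using ordLeq_transitive[OF Cf collapse_le_collapse_compose] .
      ultimately show "Q L"
        unfolding Q_def using k by blast
    qed
    then show "\<exists>C. |C| <o |L| \<and> (Q C \<longrightarrow> Q L)"
      using Df by blast
  qed (simp_all add: infinite_X card_le_subset)
  then show ?thesis
    unfolding Q_def using card_le_antisym card_le_subset[OF collapse_subset] by meson
qed

lemma injection_in_M:
  assumes "j \<in> X \<rightarrow>\<^sub>E X" "inj_on j X" "|X| \<le>o |X - j ` X|"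
  shows "j \<in> M"
proof -
  obtain h where h: "h \<in> M" "inj_on h X" "|X - h ` X| =o |X|"
    using injection_of_large_defect by blast
  have "|X - j ` X| =o |X|"
    using assms(3) by (simp add: card_le_antisym card_le_subset)
  then have "|X - h ` X| =o |X - j ` X|"
    using h(3) ordIso_symmetric ordIso_transitive by blast
  moreover have "j ` X \<subseteq> X"
    using assms(1) by auto
  ultimately obtain p where p: "p \<in> Bij X" "\<And>x. x \<in> X \<Longrightarrow> p (h x) = j x"
    using Bij_agreeing[OF h(2) M_image[OF h(1)] assms(2)] by blast
  have "compose X p h = j"
  proof (rule extensionalityI[of _ X])
    show "j \<in> extensional X"
      using assms(1) by (simp add: PiE_def)
  qed (auto simp: compose_def p)
  then show ?thesis
    using M_closed[of p h] p(1) h(1) Bij_subset by blast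
qed


text \<open>
  For regular \<open>|X|\<close> a single element \<open>K = {undefined}\<close> suffices. For singular \<open>|X|\<close>, the bound \<open>K\<close> is the
  index set of a family of fewer than \<open>|X|\<close> sets of size less than \<open>|X|\<close> with union of size
  \<open>|X|\<close>: from a set with large preimage it suffices to keep, for each member of this family, one
  element whose fibre is at least as large.
\<close>

lemma bounded_blocks:
  fixes a :: "'a \<Rightarrow> 'a"
  assumes a: "a \<in> X \<rightarrow>\<^sub>E X" "a \<notin> near_small_fibred X"
  obtains K :: "'a set" where "|K| <o |X|" "K \<noteq> {}"
    "\<And>Z :: 'a set. |Z| <o |X| \<Longrightarrow>
        \<exists>B. |B| \<le>o |K| \<and> B \<inter> Z = {} \<and> |X| \<le>o |{x \<in> X. a x \<in> B}|"
proof -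
  let ?fib = "\<lambda>y. {x \<in> X. a x = y}"
  have big: "\<exists>B. |B| <o |X| \<and> B \<inter> Z = {} \<and> |X| \<le>o |{x \<in> X. a x \<in> B}|"
    if "|Z| <o |X|" for Z :: "'a set"
  proof -
    have "\<exists>B. |B| <o |X| \<and> B \<inter> Z = {} \<and> \<not> |{x \<in> X. a x \<in> B}| <o |X|"
      using a that by (auto simp: near_small_fibred_def)
    then show ?thesis
      unfolding not_card_less_iff .
  qed
  have UN: "{x \<in> X. a x \<in> B} = (\<Union>b\<in>B. ?fib b)" for B
    by auto
  show thesis
  proof (cases "stable |X|")
    case True
    show thesis
    proof (rule that)
      show "|{undefined :: 'a}| <o |X|"
        by (intro finite_card_less_infinite infinite_X) simp
    next
      fix Z :: "'a set" assume "|Z| <o |X|"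
      then obtain B where B: "|B| <o |X|" "B \<inter> Z = {}" "|X| \<le>o |{x \<in> X. a x \<in> B}|"
        using big by blast
      \<comment> \<open>By regularity, fewer than \<open>|X|\<close> small fibres cannot have a
        union of size \<open>|X|\<close>.\<close>
      have "\<exists>b\<in>B. \<not> |?fib b| <o |X|"
      proof (rule ccontr)
        assume "\<not> ?thesis"
        then have "|\<Union>b\<in>B. ?fib b| <o |X|"
          by (intro stable_UNION[OF True B(1)]) auto
        then show False
          using B(3) unfolding UN by (simp add: not_card_less_iff[symmetric])
      qed
      then obtain b where "b \<in> B" "|X| \<le>o |?fib b|"
        unfolding not_card_less_iff by blast
      moreover have "|{b}| \<le>o |{undefined :: 'a}|"
        by (rule card_of_singl_ordLeq) simp
      ultimately show
        "\<exists>B. |B| \<le>o |{undefined :: 'a}| \<and> B \<inter> Z = {} \<and> |X| \<le>o |{x \<in> X. a x \<in> B}|"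
        using B(2) by (intro exI[of _ "{b}"]) auto
    qed simp
  next
    case False
    then obtain K F where K: "|K :: 'a set| <o |X|" "\<And>i. i \<in> K \<Longrightarrow> |F i :: 'a set| <o |X|"
      and large: "\<not> |SIGMA i:K. F i| <o |X|"
      unfolding stable_def by blast
    show thesis
    proof (rule that)
      show "|K| <o |X|" by fact
      show "K \<noteq> {}"
        using large finite_card_less_infinite[OF finite.emptyI infinite_X] by auto
    next
      fix Z :: "'a set" assume "|Z| <o |X|"
      then obtain B where B: "|B| <o |X|" "B \<inter> Z = {}" "|X| \<le>o |{x \<in> X. a x \<in> B}|"
        using big by blast
      have "\<exists>b\<in>B. |F i| \<le>o |?fib b|" if i: "i \<in> K" for i
      proof (rule ccontr)
        assume "\<not> ?thesis"
        then have "|?fib b| \<le>o |F i|" if "b \<in> B" for b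
          using that not_card_le_iff ordLess_imp_ordLeq by blast
        then have "|{x \<in> X. a x \<in> B}| \<le>o |B \<times> F i|"
          unfolding UN by (rule card_UNION_le_Times)
        then have "|{x \<in> X. a x \<in> B}| <o |X|"
          using card_Times_less[OF infinite_X B(1) K(2)[OF i]] ordLeq_ordLess_trans by blast
        then show False
          using B(3) by (simp add: not_card_less_iff[symmetric])
      qed
      then obtain b where b: "\<And>i. i \<in> K \<Longrightarrow> b i \<in> B \<and> |F i| \<le>o |?fib (b i)|"
        by metis
      define W where "W = {x \<in> X. a x \<in> b ` K}"
      have "|F i| \<le>o |W|" if "i \<in> K" for i
      proof -
        have "|?fib (b i)| \<le>o |W|"
          using that by (intro card_le_subset) (auto simp: W_def)
        then show ?thesis
          using b[OF that] ordLeq_transitive by blast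
      qed
      \<comment> \<open>Every \<open>F i\<close> is bounded by \<open>W\<close>, so
        \<open>K \<times> W\<close> is at least as large as \<open>X\<close>. Products of sets
        smaller than \<open>X\<close> stay smaller, so \<open>W\<close> has full size.\<close>
      then have "|SIGMA i:K. F i| \<le>o |K \<times> W|"
        by (intro card_of_Sigma_mono1) simp
      then have "\<not> |K \<times> W| <o |X|"
        using large ordLeq_ordLess_trans by blast
      then have "|X| \<le>o |W|"
        using card_Times_less[OF infinite_X K(1)] not_card_less_iff by blast
      moreover have "b ` K \<inter> Z = {}"
        using b B(2) by blast
      ultimately show "\<exists>B. |B| \<le>o |K| \<and> B \<inter> Z = {} \<and> |X| \<le>o |{x \<in> X. a x \<in> B}|"
        using card_of_image unfolding W_def by blast
    qed
  qed
qed

text \<open>By Zorn's lemma there is a maximal disjoint family of blocks. With fewer than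
  \<open>|X|\<close> members its union would be smaller than \<open>X\<close>, as \<open>K\<close>
  bounds all blocks, and a further nonempty block could be found outside it.\<close>

lemma disjoint_blocks:
  fixes K :: "'a set"
  assumes K: "|K| <o |X|"
    and ex: "\<And>Z. |Z| <o |X| \<Longrightarrow> \<exists>B. |B| \<le>o |K| \<and> B \<inter> Z = {} \<and> P B"
    and nonempty: "\<And>B. P B \<Longrightarrow> B \<noteq> {}"
  obtains \<F> :: "'a set set" where "pairwise disjnt \<F>" "|X| \<le>o |\<F>|"
    "\<And>B. B \<in> \<F> \<Longrightarrow> |B| \<le>o |K| \<and> P B"
proof -
  define \<A> where "\<A> = {\<F>. pairwise disjnt \<F> \<and> (\<forall>B\<in>\<F>. |B| \<le>o |K| \<and> P B)}"
  have "\<exists>M\<in>\<A>. \<forall>N\<in>\<A>. M \<subseteq> N \<longrightarrow> N = M"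
  proof (rule subset_Zorn')
    fix C assume C: "subset.chain \<A> C"
    then have "pairwise disjnt (\<Union>C)"
      by (intro pairwise_chain_Union) (auto simp: \<A>_def subset_chain_def chain_subset_def)
    then show "\<Union>C \<in> \<A>"
      using C by (auto simp: \<A>_def subset_chain_def)
  qed
  then obtain \<F> where \<F>: "\<F> \<in> \<A>" and max: "\<And>N. N \<in> \<A> \<Longrightarrow> \<F> \<subseteq> N \<Longrightarrow> N = \<F>"
    by blast
  have "|X| \<le>o |\<F>|"
  proof (rule ccontr)
    assume "\<not> |X| \<le>o |\<F>|"
    then have "|\<F>| <o |X|"
      by (simp add: not_card_le_iff)
    then have "|\<F> \<times> K| <o |X|"
      using card_Times_less infinite_X K by blast
    moreover have "|\<Union>B\<in>\<F>. B| \<le>o |\<F> \<times> K|"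
      using \<F> by (intro card_UNION_le_Times) (simp add: \<A>_def)
    ultimately have "|\<Union>\<F>| <o |X|"
      using ordLeq_ordLess_trans by simp
    then obtain B where B: "|B| \<le>o |K|" "B \<inter> \<Union>\<F> = {}" "P B"
      using ex by blast
    then have "insert B \<F> \<in> \<A>"
      using \<F> by (auto simp: \<A>_def pairwise_insert disjnt_def)
    then have "B \<in> \<F>"
      using max by blast
    then show False
      using B nonempty by blast
  qed
  then show thesis
    by (intro that[of \<F>]) (use \<F> in \<open>auto simp: \<A>_def\<close>)
qed

lemma card_eq_if_large_subset:
  assumes "A \<subseteq> X" "|X| \<le>o |A|"
  shows "|A| =o |X|"
  using assms by (simp add: card_le_antisym card_le_subset)

text \<open>A function \<open>a\<close> with many large preimages is applied twice. First it gathers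
  sets of size \<open>|X|\<close> onto small disjoint blocks; a permutation moves each block into a
  single fibre, and the second application shrinks the block to a point. A surjection of large
  collapse then spreads these points over all of \<open>X\<close>.\<close>

lemma surjection_with_large_fibres:
  "\<exists>u\<in>M. \<forall>y\<in>X. |X| \<le>o |{x \<in> X. u x = y}|"
proof -
  obtain a where aM: "a \<in> M" and a: "a \<in> X \<rightarrow>\<^sub>E X" "a \<notin> near_small_fibred X"
    using not_near_small_fibred M_subset by blast
  let ?fib = "\<lambda>y. {x \<in> X. a x = y}"
  obtain K :: "'a set" where K: "|K| <o |X|" "K \<noteq> {}"
    and blocks: "\<And>Z. |Z| <o |X| \<Longrightarrow> \<exists>B. |B| \<le>o |K| \<and> B \<inter> Z = {} \<and> |X| \<le>o |{x \<in> X. a x \<in> B}|"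
    by (rule bounded_blocks[OF a]) blast
  define P where "P B \<longleftrightarrow> B \<subseteq> a ` X \<and> |X| \<le>o |{x \<in> X. a x \<in> B}|" for B
  have ex: "\<exists>B. |B| \<le>o |K| \<and> B \<inter> Z = {} \<and> P B" if Z: "|Z| <o |X|" for Z
  proof -
    obtain B where B: "|B| \<le>o |K|" "B \<inter> Z = {}" "|X| \<le>o |{x \<in> X. a x \<in> B}|"
      using blocks[OF Z] by blast
    have "{x \<in> X. a x \<in> B} = {x \<in> X. a x \<in> B \<inter> a ` X}"
      by auto
    moreover have "|B \<inter> a ` X| \<le>o |K|"
      using B(1) card_le_subset[of "B \<inter> a ` X" B] ordLeq_transitive by blast
    ultimately show ?thesis
      using B by (intro exI[of _ "B \<inter> a ` X"]) (auto simp: P_def)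
  qed
  have nonempty: "B \<noteq> {}" if "P B" for B
    using that infinite_imp_nonempty[OF infinite_X] by (auto simp: P_def dest: card_of_empty3)
  obtain \<F> where \<F>: "pairwise disjnt \<F>" "|X| \<le>o |\<F>|"
    and \<F>_mem: "\<And>B. B \<in> \<F> \<Longrightarrow> |B| \<le>o |K| \<and> P B"
    using disjoint_blocks[of K P] K(1) ex nonempty by blast
  have disj: "B = C" if "B \<in> \<F>" "C \<in> \<F>" "x \<in> B" "x \<in> C" for x B C
    using \<F>(1) that by (auto simp: pairwise_def disjnt_def)
  have inf_\<F>: "infinite \<F>"
    using card_of_ordLeq_infinite[OF \<F>(2)] infinite_X .
  \<comment> \<open>The blocks in \<open>\<G>\<close> will be shrunk. The other half leaves
    \<open>|X|\<close> points outside both their union and the preimage of that union.\<close>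
  obtain \<G> where \<G>: "\<G> \<subseteq> \<F>" "|\<G>| =o |\<F>|" "|\<F> - \<G>| =o |\<F>|"
    using infinite_halves[OF inf_\<F>] .
  \<comment> \<open>Fibres over \<open>Y\<close> have room for a whole block. If \<open>Y\<close>
    were small, a block avoiding it would have only fibres of size at most \<open>|K|\<close>, hence
    too small a preimage.\<close>
  define Y where "Y = {y \<in> a ` X. |K| \<le>o |?fib y|}"
  have "|X| \<le>o |Y|"
  proof (rule ccontr)
    assume "\<not> |X| \<le>o |Y|"
    then have "|Y| <o |X|"
      by (simp add: not_card_le_iff)
    then obtain B where B: "|B| \<le>o |K|" "B \<inter> Y = {}" "P B"
      using ex by blast
    have "|?fib b| \<le>o |K|" if "b \<in> B" for b
    proof -
      have "\<not> |K| \<le>o |?fib b|"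
        using that B unfolding P_def Y_def by blast
      then show ?thesis
        using not_card_le_iff ordLess_imp_ordLeq by blast
    qed
    then have "|\<Union>b\<in>B. ?fib b| \<le>o |B \<times> K|"
      by (rule card_UNION_le_Times)
    moreover have "(\<Union>b\<in>B. ?fib b) = {x \<in> X. a x \<in> B}"
      by auto
    ultimately have "|{x \<in> X. a x \<in> B}| \<le>o |B \<times> K|"
      by simp
    moreover have "|B \<times> K| <o |X|"
      using card_Times_less[OF infinite_X ordLeq_ordLess_trans[OF B(1) K(1)] K(1)] .
    ultimately have "|{x \<in> X. a x \<in> B}| <o |X|"
      by (rule ordLeq_ordLess_trans)
    then show False
      using B(3) by (simp add: P_def not_card_less_iff[symmetric])
  qed
  moreover have "Y \<subseteq> X"
    using a(1) by (auto simp: Y_def)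
  ultimately have Y: "|Y| =o |X|"
    by (rule card_eq_if_large_subset[rotated])
  then have "infinite Y"
    using card_of_ordIso_finite infinite_X by blast
  \<comment> \<open>Half of \<open>Y\<close> is left out as target, so that the relocated blocks
    miss \<open>|X|\<close> points.\<close>
  then obtain Y' where Y': "Y' \<subseteq> Y" "|Y'| =o |Y|" "|Y - Y'| =o |Y|"
    using infinite_halves by blast
  have "|\<F>| \<le>o |X|"
  proof -
    have "\<F> \<subseteq> (\<lambda>x. SOME B. B \<in> \<F> \<and> x \<in> B) ` X"
    proof
      fix B assume B: "B \<in> \<F>"
      then obtain x where x: "x \<in> B" "x \<in> X"
        using \<F>_mem[OF B] nonempty a(1) unfolding P_def by blast
      have "(SOME B. B \<in> \<F> \<and> x \<in> B) = B"
        using B x disj by (intro some_equality) blast+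
      then show "B \<in> (\<lambda>x. SOME B. B \<in> \<F> \<and> x \<in> B) ` X"
        using x by auto
    qed
    then show ?thesis
      by (rule surj_imp_ordLeq)
  qed
  then have "|\<F>| =o |X|"
    using \<F>(2) card_le_antisym by blast
  then have "|\<G>| =o |Y'|"
    using ordIso_transitive[OF ordIso_transitive[OF \<G>(2)]
        ordIso_symmetric[OF ordIso_transitive[OF Y'(2) Y]]] by blast
  then obtain \<phi> where \<phi>: "bij_betw \<phi> \<G> Y'"
    using card_of_ordIso by blast
  have "\<exists>\<iota>. inj_on \<iota> B \<and> \<iota> ` B \<subseteq> ?fib (\<phi> B)" if B: "B \<in> \<G>" for B
  proof -
    have "\<phi> B \<in> Y"
      using bij_betwE[OF \<phi>] B Y'(1) by blast
    then have "|B| \<le>o |?fib (\<phi> B)|"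
      using ordLeq_transitive[of "|B|" "|K|"] \<F>_mem[of B] \<G>(1) B unfolding Y_def by blast
    then show ?thesis
      unfolding card_of_ordLeq[symmetric] .
  qed
  then obtain \<iota> where \<iota>: "\<And>B. B \<in> \<G> \<Longrightarrow> inj_on (\<iota> B) B \<and> \<iota> B ` B \<subseteq> ?fib (\<phi> B)"
    by metis
  define blk where "blk x = (THE B. B \<in> \<G> \<and> x \<in> B)" for x
  have blk: "blk x = B" if "B \<in> \<G>" "x \<in> B" for x B
    unfolding blk_def using that disj \<G>(1) by (intro the_equality) blast+
  \<comment> \<open>Each block \<open>B\<close> goes injectively into the fibre of \<open>a\<close>
    over \<open>\<phi> B\<close>, so \<open>a\<close> is constant on the relocated block.\<close>
  define p where "p x = \<iota> (blk x) x" for x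
  have p: "p x \<in> X" "a (p x) = \<phi> B" if "B \<in> \<G>" "x \<in> B" for x B
    using \<iota>[OF that(1)] that by (auto simp: p_def blk)
  have p_inj: "inj_on p (\<Union>\<G>)"
  proof (rule inj_onI)
    fix x y assume xy: "x \<in> \<Union>\<G>" "y \<in> \<Union>\<G>" "p x = p y"
    then obtain B C where BC: "B \<in> \<G>" "C \<in> \<G>" "x \<in> B" "y \<in> C"
      by blast
    then have "\<phi> B = \<phi> C"
      using p(2)[of B x] p(2)[of C y] xy by simp
    then have "B = C"
      using BC \<phi> by (auto simp: bij_betw_def inj_on_def)
    then show "x = y"
      using BC xy \<iota>[of B] by (auto simp: p_def blk dest: inj_onD)
  qed
  have co_p: "|X - p ` \<Union>\<G>| =o |X|"
  proof (rule card_eq_if_large_subset)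
    have "Y - Y' \<subseteq> a ` (X - p ` \<Union>\<G>)"
    proof
      fix y assume y: "y \<in> Y - Y'"
      then obtain x where x: "x \<in> X" "a x = y"
        by (auto simp: Y_def)
      have "x \<notin> p ` \<Union>\<G>"
        using y x p(2) bij_betwE[OF \<phi>] by auto
      then show "y \<in> a ` (X - p ` \<Union>\<G>)"
        using x by blast
    qed
    then have "|Y - Y'| \<le>o |X - p ` \<Union>\<G>|"
      by (rule surj_imp_ordLeq)
    then show "|X| \<le>o |X - p ` \<Union>\<G>|"
      by (rule ordIso_ordLeq_trans[OF ordIso_symmetric[OF ordIso_transitive[OF Y'(3) Y]]])
  qed auto
  have rest: "|X| \<le>o |\<Union>(\<F> - \<G>)|"
  proof -
    have "\<F> - \<G> \<subseteq> (\<lambda>x. THE B. B \<in> \<F> \<and> x \<in> B) ` \<Union>(\<F> - \<G>)"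
    proof
      fix B assume B: "B \<in> \<F> - \<G>"
      then obtain x where x: "x \<in> B"
        using \<F>_mem nonempty by blast
      have "(THE B. B \<in> \<F> \<and> x \<in> B) = B"
        using B x disj by (intro the_equality) blast+
      then show "B \<in> (\<lambda>x. THE B. B \<in> \<F> \<and> x \<in> B) ` \<Union>(\<F> - \<G>)"
        using x B by auto
    qed
    then have "|\<F> - \<G>| \<le>o |\<Union>(\<F> - \<G>)|"
      by (rule surj_imp_ordLeq)
    then show ?thesis
      using ordLeq_transitive[OF ordLeq_ordIso_trans[OF \<F>(2) ordIso_symmetric[OF \<G>(3)]]] by blast
  qed
  have rest_sub: "\<Union>(\<F> - \<G>) \<subseteq> a ` X - \<Union>\<G>"
  proof
    fix x assume "x \<in> \<Union>(\<F> - \<G>)"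
    then obtain B where B: "B \<in> \<F>" "B \<notin> \<G>" "x \<in> B"
      by blast
    then have "x \<notin> \<Union>\<G>"
      using disj[OF B(1) _ B(3)] \<G>(1) by blast
    then show "x \<in> a ` X - \<Union>\<G>"
      using \<F>_mem[OF B(1)] B(3) by (auto simp: P_def)
  qed
  have G_sub: "\<Union>\<G> \<subseteq> X"
  proof (rule Union_least)
    fix B assume "B \<in> \<G>"
    then have "B \<subseteq> a ` X"
      using \<F>_mem[of B] \<G>(1) by (auto simp: P_def)
    then show "B \<subseteq> X"
      using a(1) by auto
  qed
  have "|X - \<Union>\<G>| =o |X|"
  proof (rule card_eq_if_large_subset)
    have "\<Union>(\<F> - \<G>) \<subseteq> X - \<Union>\<G>"
      using rest_sub a(1) by auto
    then show "|X| \<le>o |X - \<Union>\<G>|"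
      by (rule card_le_subset_trans[OF rest])
  qed auto
  then have "|X - \<Union>\<G>| =o |X - p ` \<Union>\<G>|"
    by (rule ordIso_transitive[OF _ ordIso_symmetric[OF co_p]])
  moreover have "p ` \<Union>\<G> \<subseteq> X"
    using p(1) by auto
  ultimately obtain \<pi> where \<pi>: "\<pi> \<in> Bij X" "\<And>x. x \<in> \<Union>\<G> \<Longrightarrow> \<pi> x = p x"
    using bij_betw_extend[OF inj_on_imp_bij_betw[OF p_inj] G_sub] by blast

  define R where "R = {x \<in> X. a x \<in> \<Union>\<G>}"
  obtain B0 where B0: "B0 \<in> \<G>"
  proof -
    have "infinite \<G>"
      using card_of_ordIso_finite[OF \<G>(2)] inf_\<F> by blast
    then show thesis
      using that infinite_imp_nonempty by blast
  qed
  have "|{x \<in> X. a x \<in> B0}| \<le>o |R|"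
    by (rule card_le_subset) (use B0 in \<open>auto simp: R_def\<close>)
  then have "|X| \<le>o |R|"
    using ordLeq_transitive[of "|X|"] \<F>_mem[of B0] B0 \<G>(1) unfolding P_def by blast
  then have "|R| =o |X|"
    by (rule card_eq_if_large_subset[rotated]) (auto simp: R_def)
  then obtain j0 where j0: "bij_betw j0 X R"
    using card_of_ordIso ordIso_symmetric by blast
  \<comment> \<open>\<open>j\<close> runs through exactly the points that \<open>a\<close> sends
    into blocks of \<open>\<G>\<close>; the half kept aside gives it defect
    \<open>|X|\<close>.\<close>
  define j where "j = (\<lambda>x\<in>X. j0 x)"
  have j: "bij_betw j X R"
    using j0 by (subst bij_betw_cong[of _ _ j0]) (auto simp: j_def)
  have R_sub: "R \<subseteq> X"
    by (auto simp: R_def)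
  have "j \<in> M"
  proof (rule injection_in_M)
    show "j \<in> X \<rightarrow>\<^sub>E X"
      using bij_betwE[OF j] R_sub by (auto simp: j_def)
    show "inj_on j X"
      using j by (simp add: bij_betw_def)
    have "\<Union>(\<F> - \<G>) \<subseteq> a ` (X - R)"
      using rest_sub by (auto simp: R_def)
    then have "|\<Union>(\<F> - \<G>)| \<le>o |X - R|"
      by (rule surj_imp_ordLeq)
    then have "|X| \<le>o |X - R|"
      by (rule ordLeq_transitive[OF rest])
    then show "|X| \<le>o |X - j ` X|"
      using j by (simp add: bij_betw_def)
  qed
  \<comment> \<open>From right to left: points enter a block, the block moves into a fibre, and
    \<open>a\<close> sends the fibre to one point of \<open>Y'\<close>.\<close>
  define c where "c = compose X (compose X a \<pi>) (compose X a j)"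
  have cM: "c \<in> M"
    unfolding c_def using M_closed aM \<open>j \<in> M\<close> \<pi>(1) Bij_subset by blast
  have c: "c x = \<phi> B" if "x \<in> X" "B \<in> \<G>" "a (j x) \<in> B" for x B
  proof -
    have "a (j x) \<in> \<Union>\<G>" "a (j x) \<in> X"
      using that G_sub by auto
    then show ?thesis
      using that \<pi>(2) p(2) by (simp add: c_def compose_def)
  qed
  have c_fibre: "|X| \<le>o |{x \<in> X. c x = y}|" if y: "y \<in> Y'" for y
  proof -
    obtain B where B: "B \<in> \<G>" "y = \<phi> B"
      using y \<phi> by (auto simp: bij_betw_def)
    have "{x \<in> X. a x \<in> B} \<subseteq> j ` {x \<in> X. c x = y}"
    proof
      fix z assume z: "z \<in> {x \<in> X. a x \<in> B}"
      then have "z \<in> j ` X"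
        using B j by (auto simp: R_def bij_betw_def)
      then show "z \<in> j ` {x \<in> X. c x = y}"
        using z B c by auto
    qed
    then have "|{x \<in> X. a x \<in> B}| \<le>o |{x \<in> X. c x = y}|"
      by (rule surj_imp_ordLeq)
    then show ?thesis
      using ordLeq_transitive[of "|X|"] \<F>_mem[of B] B \<G>(1) unfolding P_def by blast
  qed

  obtain s where s: "s \<in> M" "s ` X = X" "|collapse X s| =o |X|"
    using surjection_of_large_collapse by blast
  let ?T = "X - collapse X s"
  have T: "bij_betw s ?T X"
    using inj_on_Diff_collapse[of s X] image_Diff_collapse[of s X] s(2)
    by (simp add: bij_betw_def)
  then have "|?T| =o |X|"
    using card_of_ordIso by blast
  then have "|Y'| =o |?T|"
    by (rule ordIso_transitive[OF ordIso_transitive[OF Y'(2) Y] ordIso_symmetric])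
  then obtain \<theta>0 where \<theta>0: "bij_betw \<theta>0 Y' ?T"
    using card_of_ordIso by blast
  have "|X| \<le>o |X - Y'|"
  proof -
    have "|Y - Y'| \<le>o |X - Y'|"
      using \<open>Y \<subseteq> X\<close> by (intro card_le_subset) auto
    then show ?thesis
      by (rule ordIso_ordLeq_trans[OF ordIso_symmetric[OF ordIso_transitive[OF Y'(3) Y]]])
  qed
  then have "|X - Y'| =o |X|"
    by (rule card_eq_if_large_subset[rotated]) auto
  moreover have "X - ?T = collapse X s"
    using collapse_subset[of X s] by auto
  ultimately have "|X - Y'| =o |X - ?T|"
    using ordIso_transitive[OF _ ordIso_symmetric[OF s(3)]] by simp
  \<comment> \<open>The map from \<open>Y'\<close> onto the transversal of \<open>s\<close> extends
    to a permutation because both complements have size \<open>|X|\<close>; this uses the large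
    collapse of \<open>s\<close>.\<close>
  then obtain \<theta> where \<theta>: "\<theta> \<in> Bij X" "\<And>x. x \<in> Y' \<Longrightarrow> \<theta> x = \<theta>0 x"
    using bij_betw_extend[OF \<theta>0 subset_trans[OF Y'(1) \<open>Y \<subseteq> X\<close>] Diff_subset] by blast
  define u where "u = compose X (compose X s \<theta>) c"
  have "|X| \<le>o |{x \<in> X. u x = y}|" if y: "y \<in> X" for y
  proof -
    have "y \<in> s ` ?T"
      by (simp add: image_Diff_collapse s(2) y)
    then obtain t where t: "t \<in> ?T" "s t = y"
      by blast
    then have "t \<in> \<theta>0 ` Y'"
      using \<theta>0 by (simp add: bij_betw_def)
    then obtain z where z: "z \<in> Y'" "\<theta>0 z = t"
      by blast
    have "|{x \<in> X. c x = z}| \<le>o |{x \<in> X. u x = y}|"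
      using z t \<theta>(2)[OF z(1)] Y'(1) \<open>Y \<subseteq> X\<close>
      by (intro card_le_subset) (auto simp: u_def compose_def)
    then show ?thesis
      by (rule ordLeq_transitive[OF c_fibre[OF z(1)]])
  qed
  moreover have "u \<in> M"
    unfolding u_def using M_closed s(1) cM \<theta>(1) Bij_subset by blast
  ultimately show ?thesis
    by blast
qed

text \<open>Each fibre of \<open>u\<close> has room for all of \<open>X\<close>, so preimages of the
  values of \<open>t\<close> can be chosen injectively. Using only half of each fibre secures the
  defect that puts this choice into \<open>M\<close>.\<close>

theorem M_eq_all: "M = X \<rightarrow>\<^sub>E X"
proof
  show "X \<rightarrow>\<^sub>E X \<subseteq> M"
  proof
    fix t assume t: "t \<in> X \<rightarrow>\<^sub>E X"
    obtain u where u: "u \<in> M" "\<And>y. y \<in> X \<Longrightarrow> |X| \<le>o |{x \<in> X. u x = y}|"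
      using surjection_with_large_fibres by blast
    let ?fib = "\<lambda>y. {x \<in> X. u x = y}"
    have fib: "|?fib y| =o |X|" if "y \<in> X" for y
      using u(2)[OF that] by (intro card_eq_if_large_subset) auto
    have ex_e: "\<exists>e. inj_on e X \<and> e ` X \<subseteq> ?fib y \<and> |X| \<le>o |?fib y - e ` X|" if y: "y \<in> X" for y
    proof -
      have inf: "infinite (?fib y)"
        using card_of_ordIso_finite[OF fib[OF y]] infinite_X by blast
      obtain D where D: "D \<subseteq> ?fib y" "|D| =o |?fib y|" "|?fib y - D| =o |?fib y|"
        using infinite_halves[OF inf] .
      have "|X| =o |D|"
        by (rule ordIso_symmetric[OF ordIso_transitive[OF D(2) fib[OF y]]])
      then obtain e where e: "bij_betw e X D"
        using card_of_ordIso by blast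
      have "|X| \<le>o |?fib y - D|"
        by (rule ordLeq_ordIso_trans[OF u(2)[OF y] ordIso_symmetric[OF D(3)]])
      then show ?thesis
        using e D(1) by (auto simp: bij_betw_def)
    qed
    define e where
      "e y = (SOME e. inj_on e X \<and> e ` X \<subseteq> ?fib y \<and> |X| \<le>o |?fib y - e ` X| )" for y
    have e: "inj_on (e y) X \<and> e y ` X \<subseteq> ?fib y \<and> |X| \<le>o |?fib y - e y ` X|" if "y \<in> X" for y
      unfolding e_def using someI_ex[OF ex_e[OF that]] .
    define j where "j = (\<lambda>x\<in>X. e (t x) x)"
    have tX: "t x \<in> X" if "x \<in> X" for x
      using t that by auto
    have j: "j x \<in> X" "u (j x) = t x" if "x \<in> X" for x
      using that e[OF tX[OF that]] by (auto simp: j_def)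
    have "j \<in> M"
    proof (rule injection_in_M)
      show "j \<in> X \<rightarrow>\<^sub>E X"
        using j by (auto simp: j_def)
      show "inj_on j X"
      proof (rule inj_onI)
        fix x y assume xy: "x \<in> X" "y \<in> X" "j x = j y"
        then have "t x = t y"
          using j(2) by metis
        then show "x = y"
          using xy e[OF tX[OF xy(1)]] by (auto simp: j_def dest: inj_onD)
      qed
      obtain y where y: "y \<in> X"
        using infinite_imp_nonempty[OF infinite_X] by blast
      have "?fib y - e y ` X \<subseteq> X - j ` X"
        using j(2) by (auto simp: j_def)
      then show "|X| \<le>o |X - j ` X|"
        using card_le_subset_trans e[OF y] by blast
    qed
    moreover have "compose X u j = t"
      by (rule extensionalityI[of _ X]) (use t j in \<open>auto simp: compose_def PiE_def\<close>)
    ultimately show "t \<in> M"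
      using M_closed[OF u(1)] by metis
  qed
qed (rule M_subset)

end

section \<open>Classification\<close>

text \<open>Off \<open>P'\<close> the function is a bijection onto the complement of
  \<open>Q'\<close>, while \<open>P'\<close> is sent to the value \<open>\<phi> c\<close>, which is
  attained already. Only the fibre over \<open>\<phi> c\<close> can be large, so
  \<open>{\<phi> c}\<close> serves as exceptional set.\<close>

lemma prescribed_collapse_and_defect:
  assumes X: "infinite X" and "|P| \<le>o |X|" "|Q| \<le>o |X|"
  obtains f where "f \<in> near_small_fibred X" "|collapse X f| =o |P|" "|defect X f| =o |Q|"
proof -
  obtain P' where P': "P' \<subseteq> X" "|P'| =o |P|" "|X - P'| =o |X|"
    using subset_of_cardinality_coinfinite[OF X assms(2)] .
  obtain Q' where Q': "Q' \<subseteq> X" "|Q'| =o |Q|" "|X - Q'| =o |X|"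
    using subset_of_cardinality_coinfinite[OF X assms(3)] .
  have "|X - P'| =o |X - Q'|"
    by (rule ordIso_transitive[OF P'(3) ordIso_symmetric[OF Q'(3)]])
  then obtain \<phi> where \<phi>: "bij_betw \<phi> (X - P') (X - Q')"
    using card_of_ordIso by blast
  have "infinite (X - P')"
    using card_of_ordIso_finite[OF P'(3)] X by simp
  then obtain c where c: "c \<in> X - P'"
    using infinite_imp_nonempty by blast
  define f where "f = (\<lambda>x\<in>X. if x \<in> P' then \<phi> c else \<phi> x)"
  have \<phi>_mem: "\<phi> x \<in> X - Q'" if "x \<in> X - P'" for x
    using bij_betwE[OF \<phi>] that by blast
  have f_in: "f \<in> X \<rightarrow>\<^sub>E X"
    using \<phi>_mem c by (auto simp: f_def)
  have f_eq: "f x = \<phi> x" if "x \<in> X - P'" for x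
    using that by (simp add: f_def)
  then have f_inj: "inj_on f (X - P')"
    using \<phi> inj_on_cong[of "X - P'" f \<phi>, OF f_eq] by (simp add: bij_betw_def)
  have im: "f ` (X - P') = X - Q'"
    using \<phi> image_cong[of "X - P'" "X - P'" f \<phi>, OF refl f_eq] by (simp add: bij_betw_def)
  have "f ` X \<subseteq> X - Q'"
    using \<phi>_mem c by (auto simp: f_def)
  then have imX: "f ` X = X - Q'"
    using im by blast
  have "|P'| =o |collapse X f|"
    using card_collapse_le[OF f_inj] card_le_collapse[OF P'(1)] im imX by (simp add: card_le_antisym)
  then have "|collapse X f| =o |P|"
    by (rule ordIso_transitive[OF ordIso_symmetric P'(2)])
  moreover have "defect X f = Q'"
    using Q'(1) by (auto simp: defect_def imX)
  moreover have "|{x \<in> X. f x \<in> B}| <o |X|" if B: "|B| <o |X|" "B \<inter> {\<phi> c} = {}" for B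
  proof (rule subset_card_less)
    show "|{x \<in> X - P'. f x \<in> B}| <o |X|"
      using f_inj B(1) by (rule card_vimage_inj_on_less)
  qed (use B(2) in \<open>auto simp: f_def split: if_splits\<close>)
  moreover have "|{\<phi> c}| <o |X|"
    by (intro finite_card_less_infinite X) simp
  ultimately show thesis
    using that[of f] Q'(2) f_in unfolding near_small_fibred_def by blast
qed

text \<open>The equivalences reduce comparisons of the injective and surjective kinds to a choice of
  \<open>P\<close> and \<open>Q\<close> as collapse and defect.\<close>

lemma separating_function:
  fixes X P Q :: "'a set"
  assumes X: "infinite X" and "|P| \<le>o |X|" "|Q| \<le>o |X|"
  obtains f where "f \<in> near_small_fibred X"
    "\<And>L. f \<in> near_injective X L \<longleftrightarrow> |P| <o |L| \<or> |L| \<le>o |Q|"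
    "\<And>L. f \<in> near_surjective X L \<longleftrightarrow> |Q| <o |L| \<or> |L| \<le>o |P|"
proof -
  obtain f where f: "f \<in> near_small_fibred X"
    and C: "|collapse X f| =o |P|" and D: "|defect X f| =o |Q|"
    using prescribed_collapse_and_defect[OF assms] .
  have less: "|A| <o |L| \<longleftrightarrow> |B| <o |L|" and le: "|L| \<le>o |A| \<longleftrightarrow> |L| \<le>o |B|"
    if "|A| =o |B|" for A B :: "'a set" and L :: "'a set"
    using that ordIso_ordLess_trans[of "|A|" "|B|" "|L|"] ordLeq_ordIso_trans[of "|L|" "|A|" "|B|"]
      ordIso_ordLess_trans[of "|B|" "|A|" "|L|"] ordLeq_ordIso_trans[of "|L|" "|B|" "|A|"]
      ordIso_symmetric[OF that] by auto
  have "f \<in> X \<rightarrow>\<^sub>E X"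
    using f by (simp add: near_small_fibred_def)
  then show thesis
    using that f less[OF C] less[OF D] le[OF C] le[OF D]
    by (simp add: near_injective_def near_surjective_def)
qed

text \<open>The witness that the other kinds do not lie inside \<open>near_small_fibred X\<close>:
  full collapse and defect put it into all of them for thresholds up to \<open>|X|\<close>.\<close>

lemma large_fibres_collapse_and_defect:
  assumes X: "infinite X"
  obtains w where "w \<in> X \<rightarrow>\<^sub>E X" "w \<notin> near_small_fibred X"
    "|X| \<le>o |collapse X w|" "|X| \<le>o |defect X w|"
proof -
  obtain A where A: "A \<subseteq> X" "|A| =o |X|" "|X - A| =o |X|"
    using infinite_halves[OF X] .
  obtain e where e: "bij_betw e X A"
    using ordIso_symmetric[OF A(2)] card_of_ordIso by blast
  obtain g where g: "bij_betw g X (X \<times> X)"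
    using ordIso_symmetric[OF card_of_Times_same_infinite[OF X]] card_of_ordIso by blast
  \<comment> \<open>The first projection of \<open>X \<times> X\<close> has large fibres; embedding
    its values into the half \<open>A\<close> creates the defect.\<close>
  define w where "w = (\<lambda>x\<in>X. e (fst (g x)))"
  have g_im: "\<exists>x\<in>X. g x = (y, z)" if "y \<in> X" "z \<in> X" for y z
  proof -
    have "(y, z) \<in> g ` X"
      using g that by (simp add: bij_betw_def)
    then show ?thesis by force
  qed
  have g_fst: "fst (g x) \<in> X" if "x \<in> X" for x
    using bij_betwE[OF g] that by fastforce
  have w_mem: "w x \<in> A" if "x \<in> X" for x
    using that bij_betwE[OF e] g_fst by (simp add: w_def)
  have w: "w \<in> X \<rightarrow>\<^sub>E X"
    using w_mem A(1) by (auto simp: w_def)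
  have fibre: "|X| \<le>o |{x \<in> X. w x \<in> {e y}}|" if y: "y \<in> X" for y
  proof (rule surj_imp_ordLeq)
    show "X \<subseteq> (snd \<circ> g) ` {x \<in> X. w x \<in> {e y}}"
    proof
      fix z assume "z \<in> X"
      then obtain x where "x \<in> X" "g x = (y, z)"
        using g_im y by blast
      then show "z \<in> (snd \<circ> g) ` {x \<in> X. w x \<in> {e y}}"
        by (intro image_eqI[of _ _ x]) (simp_all add: w_def)
    qed
  qed
  have "w \<notin> near_small_fibred X"
  proof
    assume "w \<in> near_small_fibred X"
    then obtain Z where Z: "|Z| <o |X|"
      "\<And>B. |B| <o |X| \<Longrightarrow> B \<inter> Z = {} \<Longrightarrow> |{x \<in> X. w x \<in> B}| <o |X|"
      by (auto simp: near_small_fibred_def)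
    have "\<not> A \<subseteq> Z"
    proof
      assume "A \<subseteq> Z"
      then have "|X| <o |X|"
        using ordIso_ordLess_trans[OF ordIso_symmetric[OF A(2)]] subset_card_less Z(1) by blast
      then show False
        using ordLess_irreflexive by blast
    qed
    then have "\<not> e ` X \<subseteq> Z"
      using e by (simp add: bij_betw_def)
    then obtain y where y: "y \<in> X" "e y \<notin> Z"
      by blast
    have "|{e y}| <o |X|"
      by (intro finite_card_less_infinite X) simp
    then have "|{x \<in> X. w x \<in> {e y}}| <o |X|"
      using y(2) by (intro Z(2)) auto
    then show False
      using fibre[OF y(1), unfolded not_card_less_iff[symmetric]] by blast
  qed
  moreover have "|X| \<le>o |collapse X w|"
  proof -
    \<comment> \<open>Every fibre contains a point with second coordinate \<open>z\<close> outside
      \<open>A\<close>, so the points with second coordinate in \<open>A\<close> are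
      redundant.\<close>
    define B where "B = {x \<in> X. snd (g x) \<in> A}"
    have "infinite (X - A)"
      using card_of_ordIso_finite[OF A(3)] X by simp
    then obtain z where z: "z \<in> X - A"
      using infinite_imp_nonempty by blast
    have "w ` X \<subseteq> w ` (X - B)"
    proof (rule image_subsetI)
      fix x assume x: "x \<in> X"
      then obtain x' where x': "x' \<in> X" "g x' = (fst (g x), z)"
        using g_im[of "fst (g x)" z] g_fst z by blast
      then have "x' \<in> X - B" "w x = w x'"
        using x z by (auto simp: B_def w_def)
      then show "w x \<in> w ` (X - B)"
        by (rule image_eqI[rotated])
    qed
    then have "w ` (X - B) = w ` X"
      by blast
    then have "|B| \<le>o |collapse X w|"
      by (intro card_le_collapse) (auto simp: B_def)
    moreover have "A \<subseteq> (snd \<circ> g) ` B"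
    proof
      fix y assume y: "y \<in> A"
      then obtain x where "x \<in> X" "g x = (y, y)"
        using g_im A(1) by blast
      then show "y \<in> (snd \<circ> g) ` B"
        using y by (intro image_eqI[of _ _ x]) (simp_all add: B_def)
    qed
    then have "|A| \<le>o |B|"
      by (rule surj_imp_ordLeq)
    ultimately show ?thesis
      using ordIso_ordLeq_trans[OF ordIso_symmetric[OF A(2)] ordLeq_transitive] by blast
  qed
  moreover have "|X| \<le>o |defect X w|"
  proof -
    have "X - A \<subseteq> defect X w"
      using w_mem by (auto simp: defect_def)
    then show ?thesis
      by (rule ordIso_ordLeq_trans[OF ordIso_symmetric[OF A(3)] card_le_subset])
  qed
  ultimately show thesis
    using that w by blast
qed

section \<open>Pairwise incomparability\<close>

lemma near_injective_cong: "|L| =o |L'| \<Longrightarrow> near_injective X L = near_injective X L'"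
  and near_surjective_cong: "|L| =o |L'| \<Longrightarrow> near_surjective X L = near_surjective X L'"
proof -
  assume L: "|L| =o |L'|"
  have less: "|A| <o |L| \<longleftrightarrow> |A| <o |L'|" for A :: "'a set"
    using ordLess_ordIso_trans[OF _ L] ordLess_ordIso_trans[OF _ ordIso_symmetric[OF L]] by blast
  then have le: "|L| \<le>o |A| \<longleftrightarrow> |L'| \<le>o |A|" for A :: "'a set"
    by (simp add: not_card_less_iff[symmetric])
  show "near_injective X L = near_injective X L'" "near_surjective X L = near_surjective X L'"
    by (simp_all add: near_injective_def near_surjective_def less le)
qed

lemma threshold_not_le_empty: "threshold L \<Longrightarrow> \<not> |L| \<le>o |{}|"
  using card_of_empty3[of L] by (auto simp: threshold_def)

context
  fixes X L :: "'a set"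
  assumes X: "infinite X" and L: "threshold L" "|L| \<le>o |X|"
begin

lemma empty_le_X: "|{}| \<le>o |X|"
  by (rule card_of_empty)

lemma X_le_X: "|X| \<le>o |X|"
  by (rule card_le_subset) simp

lemma not_X_less: "\<not> |X| <o |L|"
  using L(2) by (simp add: not_card_less_iff)

lemma near_small_fibred_not_subset_near_injective:
  "\<not> near_small_fibred X \<subseteq> near_injective X L"
  using separating_function[OF X X_le_X empty_le_X] not_X_less threshold_not_le_empty[OF L(1)]
  by (metis subsetD)

lemma near_small_fibred_not_subset_near_surjective:
  "\<not> near_small_fibred X \<subseteq> near_surjective X L"
  using separating_function[OF X empty_le_X X_le_X] not_X_less threshold_not_le_empty[OF L(1)]
  by (metis subsetD)

lemma near_injective_not_subset_near_small_fibred: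
  "\<not> near_injective X L \<subseteq> near_small_fibred X"
proof -
  obtain w where w: "w \<in> X \<rightarrow>\<^sub>E X" "w \<notin> near_small_fibred X" "|X| \<le>o |defect X w|"
    using large_fibres_collapse_and_defect[OF X] .
  then have "w \<in> near_injective X L"
    using ordLeq_transitive[OF L(2) w(3)] by (simp add: near_injective_def)
  then show ?thesis
    using w(2) by blast
qed

lemma near_surjective_not_subset_near_small_fibred:
  "\<not> near_surjective X L \<subseteq> near_small_fibred X"
proof -
  obtain w where w: "w \<in> X \<rightarrow>\<^sub>E X" "w \<notin> near_small_fibred X" "|X| \<le>o |collapse X w|"
    using large_fibres_collapse_and_defect[OF X] .
  then have "w \<in> near_surjective X L"
    using ordLeq_transitive[OF L(2) w(3)] by (simp add: near_surjective_def)
  then show ?thesis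
    using w(2) by blast
qed

text \<open>An injection of defect \<open>|X|\<close> satisfies the first condition at every
  threshold and the second at no threshold up to \<open>|X|\<close>.\<close>

lemma near_injective_not_subset_near_surjective:
  assumes L': "threshold L'" "|L'| \<le>o |X|"
  shows "\<not> near_injective X L' \<subseteq> near_surjective X L"
  using separating_function[OF X empty_le_X X_le_X] not_X_less threshold_not_le_empty[OF L(1)]
    threshold_empty[OF L'(1)]
  by (metis subsetD)

lemma near_surjective_not_subset_near_injective:
  assumes L': "threshold L'" "|L'| \<le>o |X|"
  shows "\<not> near_surjective X L' \<subseteq> near_injective X L"
  using separating_function[OF X X_le_X empty_le_X] not_X_less threshold_not_le_empty[OF L(1)]
    threshold_empty[OF L'(1)]
  by (metis subsetD)

text \<open>Either strict inequality is refuted by a function of collapse \<open>|L|\<close> and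
  defect below \<open>|L|\<close>, which is never in \<open>near_injective X L\<close>.\<close>

lemma near_injective_subset_imp_card_eq:
  assumes L': "threshold L'" "|L'| \<le>o |X|"
    and sub: "near_injective X L' \<subseteq> near_injective X L"
  shows "|L'| =o |L|"
proof (rule card_le_antisym)
  show "|L'| \<le>o |L|"
  proof (rule ccontr)
    assume "\<not> ?thesis"
    then have less: "|L| <o |L'|"
      by (simp add: not_card_le_iff)
    obtain f where f: "\<And>L'. f \<in> near_injective X L' \<longleftrightarrow> |L| <o |L'| \<or> |L'| \<le>o |{} :: 'a set|"
      using separating_function[OF X L(2) empty_le_X] by metis
    have "f \<in> near_injective X L"
      using sub f[of L'] less by blast
    then show False
      using f[of L] threshold_not_le_empty[OF L(1)] ordLess_irreflexive by blast
  qed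
  show "|L| \<le>o |L'|"
  proof (rule ccontr)
    assume "\<not> ?thesis"
    then have less: "|L'| <o |L|"
      by (simp add: not_card_le_iff)
    \<comment> \<open>Defect \<open>|L'|\<close> suffices for membership at \<open>L'\<close> but
      not at the larger \<open>L\<close>.\<close>
    obtain f where f: "\<And>M. f \<in> near_injective X M \<longleftrightarrow> |L| <o |M| \<or> |M| \<le>o |L'|"
      using separating_function[OF X L(2) L'(2)] by metis
    have "f \<in> near_injective X L'"
      using f[of L'] card_le_subset[of L' L'] by simp
    then have "f \<in> near_injective X L"
      using sub by blast
    then show False
      using f[of L] less ordLess_irreflexive[of "|L|"] by (simp add: not_card_less_iff[symmetric])
  qed
qed

lemma near_surjective_subset_imp_card_eq:
  assumes L': "threshold L'" "|L'| \<le>o |X|"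
    and sub: "near_surjective X L' \<subseteq> near_surjective X L"
  shows "|L'| =o |L|"
proof (rule card_le_antisym)
  show "|L'| \<le>o |L|"
  proof (rule ccontr)
    assume "\<not> ?thesis"
    then have less: "|L| <o |L'|"
      by (simp add: not_card_le_iff)
    obtain f where f: "\<And>M. f \<in> near_surjective X M \<longleftrightarrow> |L| <o |M| \<or> |M| \<le>o |{} :: 'a set|"
      using separating_function[OF X empty_le_X L(2)] by metis
    have "f \<in> near_surjective X L"
      using sub f[of L'] less by blast
    then show False
      using f[of L] threshold_not_le_empty[OF L(1)] ordLess_irreflexive by blast
  qed
  show "|L| \<le>o |L'|"
  proof (rule ccontr)
    assume "\<not> ?thesis"
    then have less: "|L'| <o |L|"
      by (simp add: not_card_le_iff)
    obtain f where f: "\<And>M. f \<in> near_surjective X M \<longleftrightarrow> |L| <o |M| \<or> |M| \<le>o |L'|"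
      using separating_function[OF X L'(2) L(2)] by metis
    have "f \<in> near_surjective X L'"
      using f[of L'] card_le_subset[of L' L'] by simp
    then have "f \<in> near_surjective X L"
      using sub by blast
    then show False
      using f[of L] less ordLess_irreflexive[of "|L|"] by (simp add: not_card_less_iff[symmetric])
  qed
qed

end

text \<open>The thresholds range over sets of the whole type, not only over subsets of
  \<open>X\<close>; equipotent ones give the same monoid.\<close>

definition listed_monoids :: "'a set \<Rightarrow> ('a \<Rightarrow> 'a) set set" where
  "listed_monoids X = insert (near_small_fibred X)
     (near_injective X ` {L. threshold L \<and> |L| \<le>o |X| } \<union>
      near_surjective X ` {L. threshold L \<and> |L| \<le>o |X| })"

lemma listed_monoids_cases:
  assumes "N \<in> listed_monoids X"
  obtains (small_fibred) "N = near_small_fibred X"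
  | (injective) L where "threshold L" "|L| \<le>o |X|" "N = near_injective X L"
  | (surjective) L where "threshold L" "|L| \<le>o |X|" "N = near_surjective X L"
  using assms unfolding listed_monoids_def by blast

lemma listed_monoids_antichain:
  assumes X: "infinite X" and N: "N \<in> listed_monoids X" "N' \<in> listed_monoids X" and sub: "N \<subseteq> N'"
  shows "N = N'"
  using N(1)
proof (cases rule: listed_monoids_cases)
  case small_fibred
  show ?thesis
    using N(2)
  proof (cases rule: listed_monoids_cases)
    case (injective L)
    then show ?thesis
      using near_small_fibred_not_subset_near_injective[OF X] small_fibred sub by blast
  next
    case (surjective L)
    then show ?thesis
      using near_small_fibred_not_subset_near_surjective[OF X] small_fibred sub by blast
  qed (simp add: small_fibred)
next
  case (injective L)
  show ?thesis
    using N(2)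
  proof (cases rule: listed_monoids_cases)
    case small_fibred
    then show ?thesis
      using near_injective_not_subset_near_small_fibred[OF X] injective sub by blast
  next
    case (injective L')
    then show ?thesis
      using near_injective_subset_imp_card_eq[OF X, of L' L] near_injective_cong sub
        \<open>threshold L\<close> \<open>|L| \<le>o |X|\<close> \<open>N = near_injective X L\<close> by blast
  next
    case (surjective L')
    then show ?thesis
      using near_injective_not_subset_near_surjective[OF X] injective sub by blast
  qed
next
  case (surjective L)
  show ?thesis
    using N(2)
  proof (cases rule: listed_monoids_cases)
    case small_fibred
    then show ?thesis
      using near_surjective_not_subset_near_small_fibred[OF X] surjective sub by blast
  next
    case (surjective L')
    then show ?thesis
      using near_surjective_subset_imp_card_eq[OF X, of L' L] near_surjective_cong sub
        \<open>threshold L\<close> \<open>|L| \<le>o |X|\<close> \<open>N = near_surjective X L\<close> by blast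
  next
    case (injective L')
    then show ?thesis
      using near_surjective_not_subset_near_injective[OF X] surjective sub by blast
  qed
qed

section \<open>Maximality of the listed monoids\<close>

lemma listed_monoids_submonoid:
  "infinite X \<Longrightarrow> N \<in> listed_monoids X \<Longrightarrow> submonoid N (transformation_monoid X)"
  by (auto simp: listed_monoids_def submonoid_near_injective submonoid_near_surjective
      submonoid_near_small_fibred)

lemma Bij_subset_listed_monoids:
  assumes "infinite X" "N \<in> listed_monoids X"
  shows "Bij X \<subseteq> N"
  using assms(2)
  by (cases rule: listed_monoids_cases)
    (simp_all add: Bij_subset_near_injective Bij_subset_near_surjective
      Bij_subset_near_small_fibred[OF assms(1)])

text \<open>A listed monoid equal to the whole carrier would contain two different listed monoids,
  and incomparability would identify both with it.\<close>

lemma listed_monoids_proper: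
  assumes X: "infinite X" and N: "N \<in> listed_monoids X"
  shows "N \<subset> X \<rightarrow>\<^sub>E X"
proof -
  have mem: "near_small_fibred X \<in> listed_monoids X" "near_injective X X \<in> listed_monoids X"
    using X card_le_subset[of X X] by (auto simp: listed_monoids_def threshold_def)
  have sub: "N' \<subseteq> X \<rightarrow>\<^sub>E X" if "N' \<in> listed_monoids X" for N'
    using that by (auto simp: listed_monoids_def near_small_fibred_def near_injective_def
        near_surjective_def)
  have "near_small_fibred X \<noteq> near_injective X X"
    using near_injective_not_subset_near_small_fibred[OF X, of X] X card_le_subset[of X X]
    by (auto simp: threshold_def)
  then have "N \<noteq> X \<rightarrow>\<^sub>E X"
    using listed_monoids_antichain[OF X _ N] mem sub by metis
  then show ?thesis
    using sub[OF N] by blast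
qed

lemma submonoid_above_Bij_cases:
  assumes X: "infinite X" and K: "submonoid K (transformation_monoid X)" "Bij X \<subseteq> K"
  obtains "K = X \<rightarrow>\<^sub>E X" | N where "N \<in> listed_monoids X" "K \<subseteq> N"
proof (cases "\<exists>N\<in>listed_monoids X. K \<subseteq> N")
  case False
  interpret submonoid K "transformation_monoid X"
    by (fact K(1))
  have "complete_monoid X K"
  proof
    show "K \<subseteq> X \<rightarrow>\<^sub>E X"
      using subset by (simp add: transformation_monoid_def)
    show "compose X f g \<in> K" if "f \<in> K" "g \<in> K" for f g
      using m_closed[OF that] by (simp add: transformation_monoid_def)
  qed (use X K(2) False in \<open>auto simp: listed_monoids_def\<close>)
  then show thesis
    using complete_monoid.M_eq_all that(1) by blast
qed (use that(2) in blast)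

text \<open>Every proper submonoid above the permutations lies in a listed one, and the listed ones
  form an antichain of proper submonoids.\<close>

theorem maximal_submonoids_above_perms_eq:
  assumes X: "infinite X"
  shows "maximal_submonoids_above_perms X = listed_monoids X"
proof
  have carrier: "carrier (transformation_monoid X) = X \<rightarrow>\<^sub>E X"
    by (simp add: transformation_monoid_def)
  show "maximal_submonoids_above_perms X \<subseteq> listed_monoids X"
  proof
    fix H assume "H \<in> maximal_submonoids_above_perms X"
    then have H: "submonoid H (transformation_monoid X)" "H \<noteq> X \<rightarrow>\<^sub>E X" "Bij X \<subseteq> H"
      and max: "\<And>K. submonoid K (transformation_monoid X) \<Longrightarrow> H \<subseteq> K \<Longrightarrow> K = H \<or> K = X \<rightarrow>\<^sub>E X"
      by (auto simp: maximal_submonoids_above_perms_def maximal_submonoid_def carrier)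
    obtain N where N: "N \<in> listed_monoids X" "H \<subseteq> N"
      using submonoid_above_Bij_cases[OF X H(1,3)] H(2) by blast
    then have "N = H"
      using max[OF listed_monoids_submonoid[OF X N(1)] N(2)] listed_monoids_proper[OF X N(1)] by blast
    then show "H \<in> listed_monoids X"
      using N(1) by simp
  qed
  show "listed_monoids X \<subseteq> maximal_submonoids_above_perms X"
  proof
    fix N assume N: "N \<in> listed_monoids X"
    have "K = N \<or> K = X \<rightarrow>\<^sub>E X" if K: "submonoid K (transformation_monoid X)" "N \<subseteq> K" for K
    proof -
      have "Bij X \<subseteq> K"
        using Bij_subset_listed_monoids[OF X N] K(2) by blast
      with X K(1) show ?thesis
      proof (cases rule: submonoid_above_Bij_cases)
        case (2 N')
        then have "N = N'"
          using listed_monoids_antichain[OF X N] K(2) by blast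
        then show ?thesis
          using 2 K(2) by blast
      qed simp
    qed
    then show "N \<in> maximal_submonoids_above_perms X"
      using listed_monoids_submonoid[OF X N] listed_monoids_proper[OF X N]
        Bij_subset_listed_monoids[OF X N]
      by (auto simp: maximal_submonoids_above_perms_def maximal_submonoid_def carrier)
  qed
qed

section \<open>Counting\<close>

text \<open>The definition compares only with sets over the type of \<open>Y\<close>. A set over
  another type either has a copy there or is at least as large as that whole type.\<close>

lemma least_infinite_above_le:
  fixes Y :: "'a set" and W :: "'c set"
  assumes Y: "least_infinite_above C Y" and W: "infinite W" "\<And>Z. Z \<in> C \<Longrightarrow> |Z| <o |W|"
  shows "|Y| \<le>o |W|"
proof (cases "|W| \<le>o |UNIV :: 'a set|")
  case True
  then obtain W' :: "'a set" where W': "|W'| =o |W|"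
    by (rule subset_of_cardinality)
  have "infinite W'"
    using card_of_ordIso_finite[OF W'] W(1) by simp
  moreover have "|Z| <o |W'|" if "Z \<in> C" for Z
    by (rule ordLess_ordIso_trans[OF W(2)[OF that] ordIso_symmetric[OF W']])
  ultimately have "|Y| \<le>o |W'|"
    using Y by (simp add: least_infinite_above_def)
  then show ?thesis
    by (rule ordLeq_ordIso_trans[OF _ W'])
next
  case False
  then have "|UNIV :: 'a set| \<le>o |W|"
    by (intro ordLess_imp_ordLeq) (simp add: not_card_le_iff)
  then show ?thesis
    by (rule ordLeq_transitive[OF card_le_subset, rotated]) simp
qed

lemma least_infinite_above_exists:
  fixes W :: "'a set" and C :: "'a set set"
  assumes "infinite W" "\<And>Z. Z \<in> C \<Longrightarrow> |Z| <o |W|"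
  obtains Y where "least_infinite_above C Y" "|Y| \<le>o |W|"
proof -
  let ?R = "card_of ` {W :: 'a set. infinite W \<and> (\<forall>Z\<in>C. |Z| <o |W| )}"
  have "?R \<noteq> {}"
    using assms by blast
  then have "\<exists>r\<in>?R. \<forall>r'\<in>?R. r \<le>o r'"
    by (rule exists_minim_Card_order) (auto simp: card_of_Card_order)
  then obtain Y :: "'a set" where Y: "least_infinite_above C Y"
    unfolding least_infinite_above_def by auto
  show thesis
    using that[OF Y least_infinite_above_le[OF Y assms]] .
qed

lemma least_infinite_above_cong:
  assumes Y: "least_infinite_above C Y" and eq: "|Y'| =o |Y|"
  shows "least_infinite_above C Y'"
proof -
  have inf: "infinite Y" and above: "\<And>Z. Z \<in> C \<Longrightarrow> |Z| <o |Y|"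
    using Y by (simp_all add: least_infinite_above_def)
  have "infinite Y'"
    using inf card_of_ordIso_finite[OF eq] by simp
  moreover have "|Z| <o |Y'|" if "Z \<in> C" for Z
    by (rule ordLess_ordIso_trans[OF above[OF that] ordIso_symmetric[OF eq]])
  ultimately show ?thesis
    unfolding least_infinite_above_def
    using least_infinite_above_le[OF Y] ordIso_ordLeq_trans[OF eq] by blast
qed

text \<open>No infinite cardinal is skipped: at the first \<open>c\<close> with
  \<open>|L| \<le>o |s c|\<close> all predecessors are below \<open>L\<close>, and minimality of
  \<open>s c\<close> gives the converse inequality. The relation \<open>r\<close> is general in
  order to cover both \<open>\<alpha> - Id\<close> and \<open><\<close> on the natural
  numbers.\<close>

lemma card_eq_initial_aleph:
  assumes r: "wf r" "\<And>a b. (a, b) \<in> r \<Longrightarrow> b \<in> I \<Longrightarrow> a \<in> I"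
    and s: "\<And>b. b \<in> I \<Longrightarrow> least_infinite_above (s ` {a. (a, b) \<in> r}) (s b)"
    and L: "infinite L" "b \<in> I" "|L| \<le>o |s b|"
  obtains c where "c \<in> I" "|L| =o |s c|"
proof -
  let ?Q = "{b \<in> I. |L| \<le>o |s b| }"
  have "b \<in> ?Q"
    using L by simp
  then obtain c where c: "c \<in> ?Q" and min: "\<And>a. (a, c) \<in> r \<Longrightarrow> a \<notin> ?Q"
    by (rule wfE_min[OF r(1)]) blast
  have cI: "c \<in> I" and Lc: "|L| \<le>o |s c|"
    using c by auto
  have "|s a| <o |L|" if "(a, c) \<in> r" for a
    using min[OF that] r(2)[OF that cI] by (simp add: not_card_le_iff)
  then have "|s c| \<le>o |L|"
    using least_infinite_above_le[OF s[OF cI] L(1)] by blast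
  then show thesis
    using that[OF cI] card_le_antisym[OF Lc] by blast
qed

lemma card_singletons_eq: "|{x}| =o |{y}|"
  by (intro card_le_antisym card_of_singl_ordLeq) simp_all

text \<open>Up to equipotence the thresholds are \<open>1\<close>, \<open>|X|\<close> and the alephs
  below \<open>|X|\<close>, altogether \<open>|\<alpha>| + 2\<close>. Each gives two monoids and
  \<open>near_small_fibred X\<close> is one more, so the count is
  \<open>2 (|\<alpha>| + 2) + 1\<close>.\<close>

lemma card_listed_monoids:
  fixes X :: "'a set" and \<alpha> :: "'b rel"
  assumes X: "has_card_aleph X \<alpha>"
  shows "|listed_monoids X| =o (ctwo *c |Field \<alpha>| ) +c |{..<5::nat}|"
proof -
  have wo: "Well_order \<alpha>"
    using X by (simp add: has_card_aleph_def)
  obtain s where s: "\<And>b. b \<in> Field \<alpha> \<Longrightarrow> least_infinite_above (s ` underS \<alpha> b) (s b)"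
    and sX: "least_infinite_above (s ` Field \<alpha>) X"
    using X by (auto simp: has_card_aleph_def)
  have inf_X: "infinite X" and s_less_X: "\<And>b. b \<in> Field \<alpha> \<Longrightarrow> |s b| <o |X|"
    using sX by (simp_all add: least_infinite_above_def)
  have inf_s: "infinite (s b)" if "b \<in> Field \<alpha>" for b
    using s[OF that] by (simp add: least_infinite_above_def)
  have s_less: "|s a| <o |s b|" if "a \<in> underS \<alpha> b" "b \<in> Field \<alpha>" for a b
    using s[OF that(2)] that(1) by (simp add: least_infinite_above_def)
  \<comment> \<open>\<open>Inl b\<close> stands for the aleph at \<open>b\<close>,
    \<open>Inr True\<close> for \<open>|X|\<close> and \<open>Inr False\<close> for the threshold
    \<open>1\<close>.\<close>
  define thr where "thr = case_sum s (\<lambda>c. if c then X else {undefined})"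
  define I where "I = Field \<alpha> <+> (UNIV :: bool set)"
  have single: "|{undefined :: 'a}| \<le>o |X|"
    by (intro ordLess_imp_ordLeq finite_card_less_infinite inf_X) simp
  have thr: "threshold (thr i)" "|thr i| \<le>o |X|" if "i \<in> I" for i
    using that inf_s inf_X ordLess_imp_ordLeq[OF s_less_X] card_le_subset[of X X] single
    by (auto simp: thr_def I_def threshold_def)
  have s_inj: "a = b" if "a \<in> Field \<alpha>" "b \<in> Field \<alpha>" "|s a| =o |s b|" for a b
  proof (rule ccontr)
    assume "a \<noteq> b"
    then have "a \<in> underS \<alpha> b \<or> b \<in> underS \<alpha> a"
      using that(1,2) wo by (auto simp: order_on_defs underS_def total_on_def)
    then show False
      using s_less that not_ordLess_ordIso ordIso_symmetric by blast
  qed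
  have thr_inj: "i = j" if ij: "i \<in> I" "j \<in> I" "|thr i| =o |thr j|" for i j
  proof -
    have fin: "finite (thr i) \<longleftrightarrow> finite (thr j)"
      using card_of_ordIso_finite[OF ij(3)] .
    have nX: "\<not> |s b| =o |X|" "\<not> |X| =o |s b|" if "b \<in> Field \<alpha>" for b
      using s_less_X[OF that] not_ordLess_ordIso ordIso_symmetric by blast+
    show ?thesis
      using ij fin inf_s inf_X nX s_inj
      by (auto simp: thr_def I_def split: if_splits)
  qed
  have thr_surj: "\<exists>i\<in>I. |L| =o |thr i|" if L: "threshold L" "|L| \<le>o |X|" for L
  proof (cases "infinite L")
    case False
    then obtain x where "L = {x}"
      using L(1) by (auto simp: threshold_def)
    then have "|L| =o |thr (Inr False)|"
      by (simp add: thr_def card_singletons_eq)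
    then show ?thesis
      by (auto simp: I_def)
  next
    case inf_L: True
    show ?thesis
    proof (cases "|X| \<le>o |L|")
      case True
      then have "|L| =o |thr (Inr True)|"
        using L(2) by (simp add: thr_def card_le_antisym)
      then show ?thesis
        by (auto simp: I_def)
    next
      case False
      \<comment> \<open>By minimality of \<open>X\<close>, an infinite \<open>L\<close> smaller than
        \<open>X\<close> cannot exceed all \<open>s b\<close>, so it is one of the earlier
        alephs.\<close>
      then obtain b where b: "b \<in> Field \<alpha>" "\<not> |s b| <o |L|"
        using least_infinite_above_le[OF sX inf_L] by blast
      have underS: "{a. (a, b) \<in> \<alpha> - Id} = underS \<alpha> b" for b
        by (auto simp: underS_def)
      obtain c where "c \<in> Field \<alpha>" "|L| =o |s c|"
      proof (rule card_eq_initial_aleph[of "\<alpha> - Id" "Field \<alpha>" s L b])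
        show "wf (\<alpha> - Id)"
          using wo by (simp add: well_order_on_def)
        show "a \<in> Field \<alpha>" if "(a, b) \<in> \<alpha> - Id" for a b
          using that by (auto simp: Field_def)
        show "least_infinite_above (s ` {a. (a, b) \<in> \<alpha> - Id}) (s b)" if "b \<in> Field \<alpha>" for b
          unfolding underS using that by (rule s)
        show "|L| \<le>o |s b|"
          using b(2) by (simp add: not_card_less_iff)
      qed (use inf_L b(1) in blast)+
      then have "Inl c \<in> I" "|L| =o |thr (Inl c)|"
        by (auto simp: I_def thr_def)
      then show ?thesis
        by blast
    qed
  qed
  define enc where "enc = case_sum
    (\<lambda>(c, i). if c then near_injective X (thr i) else near_surjective X (thr i))
    (\<lambda>_ :: unit. near_small_fibred X)"
  define J where "J = (UNIV :: bool set) \<times> I <+> (UNIV :: unit set)"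
  have "bij_betw enc J (listed_monoids X)"
    unfolding bij_betw_def
  proof
    have small: "near_small_fibred X \<noteq> near_injective X (thr i)"
      "near_small_fibred X \<noteq> near_surjective X (thr i)" if "i \<in> I" for i
      using near_small_fibred_not_subset_near_injective[OF inf_X thr[OF that]]
        near_small_fibred_not_subset_near_surjective[OF inf_X thr[OF that]] by auto
    have mixed: "near_injective X (thr i) \<noteq> near_surjective X (thr j)" if "i \<in> I" "j \<in> I" for i j
      using near_injective_not_subset_near_surjective[OF inf_X thr[OF that(2)] thr[OF that(1)]]
      by auto
    have inj: "near_injective X (thr i) = near_injective X (thr j) \<longleftrightarrow> i = j"
      and surj: "near_surjective X (thr i) = near_surjective X (thr j) \<longleftrightarrow> i = j"
      if "i \<in> I" "j \<in> I" for i j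
      using near_injective_subset_imp_card_eq[OF inf_X thr[OF that(2)] thr[OF that(1)]]
        near_surjective_subset_imp_card_eq[OF inf_X thr[OF that(2)] thr[OF that(1)]]
        thr_inj[OF that] by auto
    show "inj_on enc J"
      by (intro inj_onI)
        (auto simp: enc_def J_def small small[symmetric] mixed mixed[symmetric] inj surj
          split: if_splits)
    show "enc ` J = listed_monoids X"
    proof
      show "enc ` J \<subseteq> listed_monoids X"
        using thr by (auto simp: enc_def J_def listed_monoids_def split: if_splits)
      show "listed_monoids X \<subseteq> enc ` J"
      proof
        fix N assume "N \<in> listed_monoids X"
        then show "N \<in> enc ` J"
        proof (cases rule: listed_monoids_cases)
          case small_fibred
          then show ?thesis
            by (intro image_eqI[of _ _ "Inr ()"]) (auto simp: enc_def J_def)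
        next
          case (injective L)
          then obtain i where "i \<in> I" "|L| =o |thr i|"
            using thr_surj by blast
          then show ?thesis
            using near_injective_cong injective(3)
            by (intro image_eqI[of _ _ "Inl (True, i)"]) (auto simp: enc_def J_def)
        next
          case (surjective L)
          then obtain i where "i \<in> I" "|L| =o |thr i|"
            using thr_surj by blast
          then show ?thesis
            using near_surjective_cong surjective(3)
            by (intro image_eqI[of _ _ "Inl (False, i)"]) (auto simp: enc_def J_def)
        qed
      qed
    qed
  qed
  then have "|listed_monoids X| =o |J|"
    using card_of_ordIso ordIso_symmetric by blast
  \<comment> \<open>The product is distributed to split off the finite part
    \<open>2 * 2 + 1\<close>, which has five elements.\<close>
  also have "|J| =o |((UNIV :: bool set) \<times> Field \<alpha> <+> (UNIV :: bool set) \<times> (UNIV :: bool set))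
      <+> (UNIV :: unit set)|"
    unfolding J_def I_def by (intro card_of_Plus_cong1 card_of_Times_Plus_distrib)
  also have "|((UNIV :: bool set) \<times> Field \<alpha> <+> (UNIV :: bool set) \<times> (UNIV :: bool set))
      <+> (UNIV :: unit set)| =o |(UNIV :: bool set) \<times> Field \<alpha> <+>
      (UNIV :: bool set) \<times> (UNIV :: bool set) <+> (UNIV :: unit set)|"
    by (rule card_of_Plus_assoc)
  also have "|(UNIV :: bool set) \<times> Field \<alpha> <+>
      (UNIV :: bool set) \<times> (UNIV :: bool set) <+> (UNIV :: unit set)| =o
      |(UNIV :: bool set) \<times> Field \<alpha> <+> {..<5::nat}|"
  proof (rule card_of_Plus_cong2)
    have "card ((UNIV :: bool set) \<times> (UNIV :: bool set) <+> (UNIV :: unit set)) = card {..<5::nat}"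
      by (simp add: card_Plus card_cartesian_product del: UNIV_Plus_UNIV UNIV_Times_UNIV)
    then obtain f where
      "bij_betw f ((UNIV :: bool set) \<times> (UNIV :: bool set) <+> (UNIV :: unit set)) {..<5::nat}"
      using finite_same_card_bij[of "(UNIV :: bool set) \<times> (UNIV :: bool set) <+> (UNIV :: unit set)"
          "{..<5::nat}"] by auto
    then show "|(UNIV :: bool set) \<times> (UNIV :: bool set) <+> (UNIV :: unit set)| =o |{..<5::nat}|"
      using card_of_ordIso by blast
  qed
  finally show ?thesis
    by (simp add: csum_def cprod_def ctwo_def Field_card_of)
qed

section \<open>The first cardinality with infinitely many monoids\<close>

lemma has_card_aleph_infinite: "has_card_aleph X \<alpha> \<Longrightarrow> infinite X"
  by (auto simp: has_card_aleph_def least_infinite_above_def)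

text \<open>Equipotent thresholds give equal monoids, so representatives of the infinite cardinals
  up to \<open>|Y|\<close> suffice, together with \<open>{undefined}\<close> for the threshold
  \<open>1\<close>.\<close>

lemma finite_listed_monoids:
  fixes Y :: "'a set" and S :: "'a set set"
  assumes S: "finite S" "\<And>L :: 'a set. infinite L \<Longrightarrow> |L| \<le>o |Y| \<Longrightarrow> \<exists>W\<in>S. |L| =o |W|"
  shows "finite (listed_monoids Y)"
proof (rule finite_subset)
  let ?S = "insert {undefined} S"
  have ex: "\<exists>W\<in>?S. |L| =o |W|" if "threshold L" "|L| \<le>o |Y|" for L :: "'a set"
  proof (cases "infinite L")
    case True
    then show ?thesis
      using S(2)[OF _ that(2)] by blast
  next
    case False
    then show ?thesis
      using that(1) card_singletons_eq by (auto simp: threshold_def)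
  qed
  show "listed_monoids Y \<subseteq>
      insert (near_small_fibred Y) (near_injective Y ` ?S \<union> near_surjective Y ` ?S)"
  proof
    fix N assume "N \<in> listed_monoids Y"
    then show "N \<in> insert (near_small_fibred Y) (near_injective Y ` ?S \<union> near_surjective Y ` ?S)"
    proof (cases rule: listed_monoids_cases)
      case (injective L)
      then obtain W where "W \<in> ?S" "|L| =o |W|"
        using ex by blast
      then show ?thesis
        using injective(3) near_injective_cong by blast
    next
      case (surjective L)
      then obtain W where "W \<in> ?S" "|L| =o |W|"
        using ex by blast
      then show ?thesis
        using surjective(3) near_surjective_cong by blast
    qed simp
  qed
qed (simp add: S(1))

lemma infinite_if_infinite_maximal_submonoids:
  assumes "infinite (maximal_submonoids_above_perms Y)"
  shows "infinite Y"
proof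
  assume "finite Y"
  then have "finite (Pow (Y \<rightarrow>\<^sub>E Y))"
    by (simp add: finite_PiE)
  moreover have "maximal_submonoids_above_perms Y \<subseteq> Pow (Y \<rightarrow>\<^sub>E Y)"
    using submonoid.subset[of _ "transformation_monoid Y"]
    unfolding maximal_submonoids_above_perms_def maximal_submonoid_def
    by (auto simp only: transformation_monoid_def partial_object.simps)
  ultimately show False
    using assms finite_subset by blast
qed

text \<open>The alephs of finite index are built one after another below \<open>|Y|\<close>; if this
  stopped, only finitely many infinite cardinals up to \<open>|Y|\<close> would exist. The least
  cardinal above the sequence is then at most \<open>|Y|\<close> and has a copy inside
  \<open>Y\<close>.\<close>

lemma aleph_omega_subset:
  fixes Y :: "'a set"
  assumes inf: "infinite (maximal_submonoids_above_perms Y)"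
  obtains Z where "Z \<subseteq> Y" "has_card_aleph Z natLeq"
proof -
  have Y: "infinite Y"
    using inf by (rule infinite_if_infinite_maximal_submonoids)
  have inf_listed: "infinite (listed_monoids Y)"
    using inf maximal_submonoids_above_perms_eq[OF Y] by simp
  let ?r = "{(m, n :: nat). m < n}"
  define P where "P s n W \<longleftrightarrow> least_infinite_above (s ` {m. (m, n) \<in> ?r}) W \<and> |W| <o |Y|"
    for s :: "nat \<Rightarrow> 'a set" and n W
  \<comment> \<open>\<open>P\<close> depends on its first argument only through the values before
    \<open>n\<close>, which permits recursive choice.\<close>
  have "\<exists>s. \<forall>n. P s n (s n)"
  proof (rule dependent_wf_choice)
    show "wf ?r"
      by (rule wf_less)
    show "P f x r = P g x r" if "\<And>z. (z, x) \<in> ?r \<Longrightarrow> f z = g z" for f g x r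
    proof -
      have "f ` {m. (m, x) \<in> ?r} = g ` {m. (m, x) \<in> ?r}"
        using that by (intro image_cong) auto
      then show ?thesis
        by (simp only: P_def)
    qed
    fix n and s :: "nat \<Rightarrow> 'a set"
    assume s: "\<And>m. (m, n) \<in> ?r \<Longrightarrow> P s m (s m)"
    then have above: "|U| <o |Y|" if "U \<in> s ` {m. (m, n) \<in> ?r}" for U
      using that by (auto simp: P_def)
    obtain W where W: "least_infinite_above (s ` {m. (m, n) \<in> ?r}) W" "|W| \<le>o |Y|"
      using least_infinite_above_exists[OF Y above] .
    have "|W| <o |Y|"
    proof (rule ccontr)
      assume "\<not> |W| <o |Y|"
      \<comment> \<open>Now \<open>W\<close> is as large as \<open>Y\<close>, so an infinite
        \<open>L\<close> smaller than \<open>Y\<close> fails to exceed some \<open>s m\<close> with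
        \<open>m < n\<close> and is equipotent to one of these sets.\<close>
      then have YW: "|Y| \<le>o |W|"
        by (simp add: not_card_less_iff)
      have "finite (listed_monoids Y)"
      proof (rule finite_listed_monoids)
        show "finite (insert Y (s ` {m. (m, n) \<in> ?r}))"
          by simp
        fix L :: "'a set" assume L: "infinite L" "|L| \<le>o |Y|"
        show "\<exists>W\<in>insert Y (s ` {m. (m, n) \<in> ?r}). |L| =o |W|"
        proof (cases "|Y| \<le>o |L|")
          case True
          then show ?thesis
            using card_le_antisym[OF L(2)] by blast
        next
          case False
          then have "\<not> |W| \<le>o |L|"
            using ordLeq_transitive[OF YW] by blast
          then obtain m where m: "m < n" "\<not> |s m| <o |L|"
            using least_infinite_above_le[OF W(1) L(1)] by auto
          obtain c where "c \<in> {..<n}" "|L| =o |s c|"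
          proof (rule card_eq_initial_aleph[of ?r "{..<n}" s L m])
            show "wf ?r"
              by (rule wf_less)
            show "least_infinite_above (s ` {a. (a, b) \<in> ?r}) (s b)" if "b \<in> {..<n}" for b
              using s[of b] that by (simp add: P_def)
            show "|L| \<le>o |s m|"
              using m(2) by (simp add: not_card_less_iff)
          qed (use L m in auto)
          then show ?thesis
            by auto
        qed
      qed
      then show False
        using inf_listed by contradiction
    qed
    then show "\<exists>W. P s n W"
      using W(1) unfolding P_def by blast
  qed
  then obtain s where s: "\<And>n. P s n (s n)"
    by blast
  have "|U| <o |Y|" if "U \<in> range s" for U
    using s that by (auto simp: P_def)
  then obtain W where W: "least_infinite_above (range s) W" "|W| \<le>o |Y|"
    by (rule least_infinite_above_exists[OF Y])
  obtain Z where Z: "Z \<subseteq> Y" "|Z| =o |W|"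
    using subset_of_cardinality[OF W(2)] .
  have "least_infinite_above (s ` Field natLeq) Z"
    using least_infinite_above_cong[OF W(1) Z(2)] by (simp add: Field_natLeq)
  moreover have "least_infinite_above (s ` underS natLeq n) (s n)" for n
    using s[of n] by (simp add: P_def natLeq_underS_less)
  ultimately have "has_card_aleph Z natLeq"
    using natLeq_Well_order by (auto simp: has_card_aleph_def)
  then show thesis
    using that Z(1) by blast
qed

text \<open>The sequences of alephs may live over different types and are compared index by index,
  using minimality at each stage.\<close>

lemma has_card_aleph_le:
  fixes X :: "'a set" and Z :: "'c set"
  assumes X: "has_card_aleph X natLeq" and Z: "has_card_aleph Z natLeq"
  shows "|X| \<le>o |Z|"
proof -
  obtain s :: "nat \<Rightarrow> 'a set" where s: "\<And>n. least_infinite_above (s ` {m. m < n}) (s n)"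
    "least_infinite_above (range s) X"
    using X by (auto simp: has_card_aleph_def Field_natLeq natLeq_underS_less)
  obtain t :: "nat \<Rightarrow> 'c set" where t: "\<And>n. least_infinite_above (t ` {m. m < n}) (t n)"
    "least_infinite_above (range t) Z"
    using Z by (auto simp: has_card_aleph_def Field_natLeq natLeq_underS_less)
  have st: "|s n| \<le>o |t n|" for n
  proof (induction n rule: less_induct)
    case (less n)
    show ?case
    proof (rule least_infinite_above_le[OF s(1)])
      show "infinite (t n)"
        using t(1)[of n] by (simp add: least_infinite_above_def)
      fix U assume "U \<in> s ` {m. m < n}"
      then obtain m where m: "m < n" "U = s m"
        by blast
      then have "|t m| <o |t n|"
        using t(1)[of n] by (auto simp: least_infinite_above_def)
      then show "|U| <o |t n|"
        using ordLeq_ordLess_trans[OF less[OF m(1)]] m(2) by simp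
    qed
  qed
  show ?thesis
  proof (rule least_infinite_above_le[OF s(2)])
    show "infinite Z"
      using Z by (rule has_card_aleph_infinite)
    fix U assume "U \<in> range s"
    then obtain n where n: "U = s n"
      by blast
    have "|t n| <o |Z|"
      using t(2) by (simp add: least_infinite_above_def)
    then show "|U| <o |Z|"
      using ordLeq_ordLess_trans[OF st] n by simp
  qed
qed

text \<open>The ordinal \<omega> is represented by \<open>natLeq\<close>. The type of
  \<open>X\<close> may be too small for a set of size aleph-omega, so the last conjunct finds such a
  set inside \<open>Y\<close> itself, and minimality does not hinge on a given
  \<open>X\<close>.\<close>

theorem corollary5:
  fixes X :: "'a set" and Y :: "'c set" and \<alpha> :: "'b rel"
  shows "(has_card_aleph X \<alpha> \<longrightarrow>
           |maximal_submonoids_above_perms X| =o (ctwo *c |Field \<alpha>| ) +c |{..<5::nat}| )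
       \<and> (has_card_aleph X natLeq \<longrightarrow>
           infinite (maximal_submonoids_above_perms X) \<and>
           (infinite (maximal_submonoids_above_perms Y) \<longrightarrow> |X| \<le>o |Y| ))
       \<and> (infinite (maximal_submonoids_above_perms Y) \<longrightarrow>
           (\<exists>Z\<subseteq>Y. has_card_aleph Z natLeq))"
proof (intro conjI impI)
  show "|maximal_submonoids_above_perms X| =o (ctwo *c |Field \<alpha>| ) +c |{..<5::nat}|"
    if "has_card_aleph X \<alpha>"
    using card_listed_monoids[OF that] maximal_submonoids_above_perms_eq[OF has_card_aleph_infinite[OF that]]
    by simp
  show "\<exists>Z\<subseteq>Y. has_card_aleph Z natLeq" if "infinite (maximal_submonoids_above_perms Y)"
    using aleph_omega_subset[OF that] by blast
  assume X: "has_card_aleph X natLeq"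
  have "|maximal_submonoids_above_perms X| =o
      |(UNIV :: bool set) \<times> (UNIV :: nat set) <+> {..<5::nat}|"
    using card_listed_monoids[OF X] maximal_submonoids_above_perms_eq[OF has_card_aleph_infinite[OF X]]
    by (simp add: csum_def cprod_def ctwo_def Field_card_of Field_natLeq)
  then show "infinite (maximal_submonoids_above_perms X)"
    by (simp add: card_of_ordIso_finite finite_prod)
  show "|X| \<le>o |Y|" if Y: "infinite (maximal_submonoids_above_perms Y)"
  proof -
    obtain Z where Z: "Z \<subseteq> Y" "has_card_aleph Z natLeq"
      using aleph_omega_subset[OF Y] .
    show ?thesis
      by (rule card_le_subset_trans[OF has_card_aleph_le[OF X Z(2)] Z(1)])
  qed
qed

end
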